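(* Let $S$ be a string of length $n$ over an alphabet $\Sigma$ in which each letter appears at most 3 times. Whether $S$ has a letter-duplicated subsequence in which every letter of $\Sigma$ appears (i.e., whether FT$(3)$ has a solution) can be decided in $O(n^2)$ time.
   Context: A subsequence of $S$ is a letter-duplicated subsequence (LDS) if it has the form $x_1^{d_1}x_2^{d_2}\cdots x_k^{d_k}$ with $x_i\in\Sigma$, $x_j\neq x_{j+1}$ and $d_i\geq 2$ for all $i\in[k]$, $j\in[k-1]$. *)

theory Defs
  imports Complex_Main "HOL-Library.Sublist" "HOL-Library.Landau_Symbols"
begin

section \<open>Letter-duplicated subsequences\<close>

text \<open>The word \<open>x\<^sub>1^d\<^sub>1 \<dots> x\<^sub>k^d\<^sub>k\<close> is given by the list of its blocks
  \<open>(x\<^sub>i, d\<^sub>i)\<close>; the empty word (\<open>k = 0\<close>) is admitted.\<close>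

definition letter_duplicated :: "'a set \<Rightarrow> 'a list \<Rightarrow> bool" where
  "letter_duplicated \<Sigma> w \<longleftrightarrow>
     (\<exists>bs :: ('a \<times> nat) list.
        w = concat (map (\<lambda>(x, d). replicate d x) bs) \<and>
        (\<forall>i < length bs. fst (bs ! i) \<in> \<Sigma> \<and> snd (bs ! i) \<ge> 2) \<and>
        (\<forall>j. Suc j < length bs \<longrightarrow> fst (bs ! j) \<noteq> fst (bs ! Suc j)))"

definition is_LDS :: "'a set \<Rightarrow> 'a list \<Rightarrow> 'a list \<Rightarrow> bool" where
  "is_LDS \<Sigma> S w \<longleftrightarrow> subseq w S \<and> letter_duplicated \<Sigma> w"

text \<open>An instance of \<open>FT(d)\<close> is a pair \<open>(\<sigma>, S)\<close>: the alphabet is \<open>{0, \<dots>, \<sigma> - 1}\<close>,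
  and \<open>S\<close> is a string over it. Letters of the alphabet may be absent from \<open>S\<close>.\<close>

definition FT_instances :: "nat \<Rightarrow> (nat \<times> nat list) set" where
  "FT_instances d = {(\<sigma>, S). set S \<subseteq> {..<\<sigma>} \<and> (\<forall>a < \<sigma>. count_list S a \<le> d)}"

definition FT_solvable :: "nat \<times> nat list \<Rightarrow> bool" where
  "FT_solvable = (\<lambda>(\<sigma>, S). \<exists>w. is_LDS {..<\<sigma>} S w \<and> {..<\<sigma>} \<subseteq> set w)"

definition FT_size :: "nat \<times> nat list \<Rightarrow> nat" where
  "FT_size = (\<lambda>(\<sigma>, S). length S)"

definition FT_encoding :: "nat \<times> nat list \<Rightarrow> nat list" where
  "FT_encoding = (\<lambda>(\<sigma>, S). \<sigma> # length S # S)"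

section \<open>Random access machines\<close>

text \<open>A random access machine in the style of Cook and Reckhow, with registers
  \<open>X\<^sub>0, X\<^sub>1, \<dots>\<close> over the natural numbers and a read-once input tape; every instruction
  takes one time step. Subtraction is truncated at zero, and reading past the end of the
  input yields zero.\<close>

datatype instr =
    Const nat nat      \<comment> \<open>\<open>X\<^sub>i := c\<close>\<close>
  | Add nat nat nat    \<comment> \<open>\<open>X\<^sub>i := X\<^sub>j + X\<^sub>k\<close>\<close>
  | Sub nat nat nat    \<comment> \<open>\<open>X\<^sub>i := X\<^sub>j - X\<^sub>k\<close>\<close>
  | Load nat nat       \<comment> \<open>\<open>X\<^sub>i := X[X\<^sub>j]\<close>\<close>
  | Store nat nat      \<comment> \<open>\<open>X[X\<^sub>i] := X\<^sub>j\<close>\<close>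
  | JumpPos nat nat    \<comment> \<open>if \<open>X\<^sub>i > 0\<close> go to instruction \<open>l\<close>\<close>
  | Read nat           \<comment> \<open>\<open>X\<^sub>i := \<close> next input value\<close>

text \<open>A configuration consists of the program counter, the registers and the unread input.\<close>

type_synonym config = "nat \<times> (nat \<Rightarrow> nat) \<times> nat list"

fun exec :: "instr \<Rightarrow> config \<Rightarrow> config" where
  "exec (Const i c) (pc, X, xs) = (pc + 1, X(i := c), xs)"
| "exec (Add i j k) (pc, X, xs) = (pc + 1, X(i := X j + X k), xs)"
| "exec (Sub i j k) (pc, X, xs) = (pc + 1, X(i := X j - X k), xs)"
| "exec (Load i j) (pc, X, xs) = (pc + 1, X(i := X (X j)), xs)"
| "exec (Store i j) (pc, X, xs) = (pc + 1, X(X i := X j), xs)"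
| "exec (JumpPos i l) (pc, X, xs) = (if X i > 0 then l else pc + 1, X, xs)"
| "exec (Read i) (pc, X, xs) =
     (pc + 1, X(i := (case xs of [] \<Rightarrow> 0 | x # _ \<Rightarrow> x)), tl xs)"

definition halted :: "instr list \<Rightarrow> config \<Rightarrow> bool" where
  "halted p c \<longleftrightarrow> fst c \<ge> length p"

definition step :: "instr list \<Rightarrow> config \<Rightarrow> config" where
  "step p c = (if halted p c then c else exec (p ! fst c) c)"

definition run :: "instr list \<Rightarrow> nat list \<Rightarrow> nat \<Rightarrow> config" where
  "run p xs t = (step p ^^ t) (0, (\<lambda>_. 0), xs)"

definition reg :: "config \<Rightarrow> nat \<Rightarrow> nat" where
  "reg c = fst (snd c)"

text \<open>The answer is read off register \<open>X\<^sub>0\<close> on halting. In order that unit cost per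
  instruction be justified, the registers may only ever hold values polynomial in the length
  and the largest entry of the input, i.e. words of logarithmically many bits.\<close>

definition word_bounded :: "instr list \<Rightarrow> nat \<Rightarrow> nat list \<Rightarrow> bool" where
  "word_bounded p k xs \<longleftrightarrow>
     (\<forall>t i. reg (run p xs t) i \<le> (length xs + Max (insert 0 (set xs)) + 2) ^ k)"

definition decides_within :: "instr list \<Rightarrow> nat list \<Rightarrow> bool \<Rightarrow> nat \<Rightarrow> bool" where
  "decides_within p xs b t \<longleftrightarrow>
     halted p (run p xs t) \<and> reg (run p xs t) 0 = (if b then 1 else 0)"

text \<open>The decision problem \<open>Q\<close> on the set \<open>I\<close> of instances, with input encoding \<open>enc\<close>, can be
  decided in time \<open>O(f(n))\<close>, where \<open>n\<close> is the size of the instance. Nothing is required of the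
  program on inputs that do not encode an element of \<open>I\<close>.\<close>

definition decidable_in_time_O ::
  "'i set \<Rightarrow> ('i \<Rightarrow> nat list) \<Rightarrow> ('i \<Rightarrow> nat) \<Rightarrow> ('i \<Rightarrow> bool) \<Rightarrow> (nat \<Rightarrow> real) \<Rightarrow> bool" where
  "decidable_in_time_O I enc sz Q f \<longleftrightarrow>
     (\<exists>p k (T :: nat \<Rightarrow> nat).
        (\<lambda>n. real (T n)) \<in> O(f) \<and>
        (\<forall>x \<in> I. word_bounded p k (enc x) \<and>
                 decides_within p (enc x) (Q x) (T (sz x))))"

end

theory Submission
  imports Defs "HOL-Library.Disjoint_Sets" "HOL-Real_Asymp.Real_Asymp"
begin

text \<open>
  A letter occurring at most three times forms at most one block, and this block may be assumed to
  consist of two consecutive occurrences. So every letter chooses one of at most two intervals of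
  positions, identified with their right ends, and a solution is a choice of pairwise disjoint
  intervals. This is a 2-SAT instance with up to quadratically many clauses.

  A disjoint choice \<open>C\<close> is maintained while the letters are inserted one by one. In order to insert
  a letter with interval \<open>e0\<close>, the positions of \<open>e0\<close> are claimed one after the other. Whenever a
  position belongs to an interval of \<open>C\<close>, the letter of that interval is forced to change to its
  other interval, which is queued in order to be claimed as well. If there is no other interval, or
  if a position is claimed twice, then \<open>e0\<close> belongs to no solution; otherwise the changed choice is
  again disjoint. No position is claimed twice before an attempt ends, so an attempt takes linear
  time, and each letter needs at most two attempts.

  The algorithm is written in a while language that is compiled to the machine with a constant
  slowdown. As the commands of this language increase values only by one at a time,
  word-boundedness follows from the time bound.\<close>

section \<open>Selections of disjoint intervals\<close>

text \<open>Positions are counted from 1, and 0 stands for a missing occurrence.\<close>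

primrec last_occ :: "'a list \<Rightarrow> 'a \<Rightarrow> nat \<Rightarrow> nat" where
  "last_occ S a 0 = 0"
| "last_occ S a (Suc i) = (if S ! i = a then Suc i else last_occ S a i)"

definition letter :: "'a list \<Rightarrow> nat \<Rightarrow> 'a" where
  "letter S k = S ! (k - 1)"

definition prev_occ :: "'a list \<Rightarrow> nat \<Rightarrow> nat" where
  "prev_occ S k = last_occ S (letter S k) (k - 1)"

definition pair_ends :: "'a list \<Rightarrow> nat set" where
  "pair_ends S = {e. e \<le> length S \<and> 0 < prev_occ S e}"

definition interval :: "'a list \<Rightarrow> nat \<Rightarrow> nat set" where
  "interval S e = {prev_occ S e..e}"

definition selection :: "'a list \<Rightarrow> 'a set \<Rightarrow> nat set \<Rightarrow> bool" where
  "selection S B C \<longleftrightarrow>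
     C \<subseteq> pair_ends S \<and> bij_betw (letter S) C B \<and> disjoint_family_on (interval S) C"

lemma last_occ_le: "last_occ S a i \<le> i"
  by (induction i) auto

lemma letter_last_occ: "0 < last_occ S a i \<Longrightarrow> letter S (last_occ S a i) = a"
  by (induction i) (auto simp: letter_def split: if_splits)

lemma last_occ_greatest: "0 < j \<Longrightarrow> j \<le> i \<Longrightarrow> letter S j = a \<Longrightarrow> j \<le> last_occ S a i"
proof (induction i)
  case (Suc i)
  then show ?case by (cases "j = Suc i") (auto simp: letter_def)
qed simp

lemma prev_occ_0 [simp]: "prev_occ S 0 = 0"
  by (simp add: prev_occ_def)

lemma prev_occ_le: "prev_occ S k \<le> k"
  using last_occ_le[of S "letter S k" "k - 1"] by (simp add: prev_occ_def)

lemma prev_occ_less: "0 < k \<Longrightarrow> prev_occ S k < k"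
  using last_occ_le[of S "letter S k" "k - 1"] by (auto simp: prev_occ_def)

lemma letter_prev_occ: "0 < prev_occ S k \<Longrightarrow> letter S (prev_occ S k) = letter S k"
  by (simp add: prev_occ_def letter_last_occ)

lemma prev_occ_greatest: "0 < j \<Longrightarrow> j < k \<Longrightarrow> letter S j = letter S k \<Longrightarrow> j \<le> prev_occ S k"
  by (simp add: prev_occ_def last_occ_greatest)

lemma pair_endsD:
  assumes "e \<in> pair_ends S"
  shows "0 < prev_occ S e" "prev_occ S e < e" "0 < e" "e \<le> length S"
proof -
  show "0 < prev_occ S e" "e \<le> length S" using assms by (auto simp: pair_ends_def)
  then show "0 < e" using prev_occ_le[of S e] by linarith
  then show "prev_occ S e < e" by (rule prev_occ_less)
qed

lemma pair_ends_subset: "pair_ends S \<subseteq> {1..length S}"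
  using pair_endsD(3,4) by (force simp: Suc_le_eq)

lemma interval_subset: "e \<in> pair_ends S \<Longrightarrow> interval S e \<subseteq> {1..length S}"
  using pair_endsD[of e S] by (auto simp: interval_def)

lemma pair_end_in_interval: "e \<in> pair_ends S \<Longrightarrow> e \<in> interval S e"
  using pair_endsD[of e S] by (simp add: interval_def)

lemma letter_append_left: "k \<in> {1..length S} \<Longrightarrow> letter (S @ T) k = letter S k"
  by (auto simp: letter_def nth_append)

lemma letter_append_right: "0 < k \<Longrightarrow> letter (S @ T) (length S + k) = letter T k"
  by (cases k) (simp_all add: letter_def nth_append)

lemma last_occ_append_left: "i \<le> length S \<Longrightarrow> last_occ (S @ T) a i = last_occ S a i"
  by (induction i) (auto simp: nth_append)

lemma last_occ_append_right:
  "0 < last_occ T a i \<Longrightarrow> last_occ (S @ T) a (length S + i) = length S + last_occ T a i"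
  by (induction i) (auto simp: nth_append split: if_splits)

lemma prev_occ_append_left: "k \<in> {1..length S} \<Longrightarrow> prev_occ (S @ T) k = prev_occ S k"
  using letter_append_left[of k S T] by (auto simp: prev_occ_def last_occ_append_left)

lemma prev_occ_append_right:
  assumes "0 < prev_occ T k"
  shows "prev_occ (S @ T) (length S + k) = length S + prev_occ T k"
proof -
  have "0 < k" using assms by (cases k) auto
  then show ?thesis
    using assms letter_append_right[of k S T] last_occ_append_right[of T "letter T k" "k - 1" S]
    by (simp add: prev_occ_def)
qed

lemma selectionD:
  assumes "selection S B C"
  shows "C \<subseteq> pair_ends S" "inj_on (letter S) C" "letter S ` C = B"
    "disjoint_family_on (interval S) C"
  using assms by (auto simp: selection_def bij_betw_def)

lemma selection_card_le:
  assumes "selection S B C"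
  shows "card B \<le> length S"
proof -
  have "card B = card C" using card_image[of "letter S" C] selectionD(2,3)[OF assms] by simp
  also have "C \<subseteq> {1..length S}" using selectionD(1)[OF assms] pair_ends_subset by blast
  then have "card C \<le> length S" using card_mono[of "{1..length S}" C] by simp
  finally show ?thesis .
qed

lemma selection_Un:
  assumes "selection S B C" "selection S B' C'" "B \<inter> B' = {}"
    and "\<And>d e. d \<in> C \<Longrightarrow> e \<in> C' \<Longrightarrow> interval S d \<inter> interval S e = {}"
  shows "selection S (B \<union> B') (C \<union> C')"
  unfolding selection_def
proof (intro conjI)
  show "bij_betw (letter S) (C \<union> C') (B \<union> B')"
    using assms(1-3) by (intro bij_betw_combine) (auto simp: selection_def)
  show "disjoint_family_on (interval S) (C \<union> C')"
    using assms(4) selectionD(4)[OF assms(1)] selectionD(4)[OF assms(2)]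
    unfolding disjoint_family_on_def by (metis Int_commute UnE)
qed (use assms(1,2) in \<open>auto simp: selection_def\<close>)

lemma selection_restrict:
  assumes "selection S B C" "A \<subseteq> B"
  shows "selection S A {e \<in> C. letter S e \<in> A}"
proof -
  let ?D = "{e \<in> C. letter S e \<in> A}"
  note C = selectionD[OF assms(1)]
  have "letter S ` ?D = A" using C(3) assms(2) by blast
  moreover have "inj_on (letter S) ?D" using C(2) by (rule inj_on_subset) blast
  moreover have "disjoint_family_on (interval S) ?D"
    using C(4) by (rule disjoint_family_on_mono[rotated]) blast
  ultimately show ?thesis using C(1) unfolding selection_def bij_betw_def by blast
qed

lemma selection_append_left_iff:
  assumes "C \<subseteq> {1..length S}"
  shows "selection (S @ T) B C \<longleftrightarrow> selection S B C"
proof -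
  have same: "letter (S @ T) e = letter S e" "prev_occ (S @ T) e = prev_occ S e" if "e \<in> C" for e
    by (rule letter_append_left prev_occ_append_left, use that assms in blast)+
  then have "C \<subseteq> pair_ends (S @ T) \<longleftrightarrow> C \<subseteq> pair_ends S"
    using assms by (fastforce simp: pair_ends_def)
  moreover have "bij_betw (letter (S @ T)) C B \<longleftrightarrow> bij_betw (letter S) C B"
    using same by (intro bij_betw_cong) auto
  moreover have "disjoint_family_on (interval (S @ T)) C \<longleftrightarrow> disjoint_family_on (interval S) C"
    using same by (auto simp: disjoint_family_on_def interval_def)
  ultimately show ?thesis by (simp add: selection_def)
qed

lemma selection_append_right:
  assumes "selection T B C"
  shows "selection (S @ T) B ((+) (length S) ` C)"
proof -
  let ?shift = "(+) (length S)"
  have ends: "C \<subseteq> pair_ends T" using assms by (simp add: selection_def)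
  have letter: "letter (S @ T) (?shift e) = letter T e"
    and prev: "prev_occ (S @ T) (?shift e) = ?shift (prev_occ T e)" if "e \<in> C" for e
    by (rule letter_append_right prev_occ_append_right, use that ends pair_endsD in blast)+
  have "bij_betw (letter (S @ T) \<circ> ?shift) C B"
    using assms letter bij_betw_cong[of C "letter (S @ T) \<circ> ?shift"] by (simp add: selection_def)
  then have "bij_betw (letter (S @ T)) (?shift ` C) B"
    by (subst bij_betw_comp_iff[of ?shift C]) (auto simp: bij_betw_def)
  moreover have "interval (S @ T) (?shift e) = ?shift ` interval T e" if "e \<in> C" for e
    using prev[OF that] by (simp add: interval_def)
  then have "disjoint_family_on (interval (S @ T)) (?shift ` C)"
    using assms by (fastforce simp: selection_def disjoint_family_on_def)
  moreover have "?shift ` C \<subseteq> pair_ends (S @ T)"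
    using ends prev by (auto simp: pair_ends_def)
  ultimately show ?thesis by (simp add: selection_def)
qed

lemma selection_append:
  assumes "selection S B C" "selection T B' C'" "B \<inter> B' = {}"
  shows "selection (S @ T) (B \<union> B') (C \<union> (+) (length S) ` C')"
proof (rule selection_Un)
  have C: "C \<subseteq> {1..length S}" "C \<subseteq> pair_ends S"
    using assms(1) pair_endsD[of _ S] by (fastforce simp: selection_def)+
  then show left: "selection (S @ T) B C" using assms(1) selection_append_left_iff by blast
  show right: "selection (S @ T) B' ((+) (length S) ` C')"
    using assms(2) by (rule selection_append_right)
  fix d e assume d: "d \<in> C" and "e \<in> (+) (length S) ` C'"
  then obtain e' where e': "e' \<in> C'" "e = length S + e'" by blast
  then have "0 < prev_occ T e'" using assms(2) by (auto simp: selection_def pair_ends_def)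
  then have "length S < prev_occ (S @ T) e" using e'(2) prev_occ_append_right[of T e' S] by simp
  moreover have "d \<le> length S" using d C by auto
  ultimately show "interval (S @ T) d \<inter> interval (S @ T) e = {}" by (auto simp: interval_def)
qed (fact assms(3))

lemma selection_singleton: "e \<in> pair_ends S \<Longrightarrow> selection S {letter S e} {e}"
  by (simp add: selection_def bij_betw_def disjoint_family_on_def)

lemma selection_empty: "selection S {} {}"
  by (simp add: selection_def bij_betw_def disjoint_family_on_def)

lemma ex_pair_end_if_subseq:
  assumes "subseq [x, x] S"
  obtains e where "e \<in> pair_ends S" "letter S e = x"
proof -
  obtain us vs where S: "S = us @ x # vs" and "subseq [x] vs"
    using assms by (auto dest!: list_emb_ConsD)
  then obtain i where i: "i < length vs" "vs ! i = x"
    by (auto simp: subseq_singleton_left in_set_conv_nth)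
  let ?k = "Suc (length us)" and ?e = "Suc (Suc (length us + i))"
  have "letter S ?k = x" "letter S ?e = x" using i by (simp_all add: S letter_def nth_append)
  moreover from this have "?k \<le> prev_occ S ?e" by (intro prev_occ_greatest) auto
  ultimately show ?thesis using i(1) by (intro that[of ?e]) (auto simp: pair_ends_def S)
qed

lemma subseq_if_pair_end:
  assumes "e \<in> pair_ends S"
  shows "subseq [letter S e, letter S e] (drop (prev_occ S e - 1) S)"
proof -
  let ?p = "prev_occ S e"
  note e = pair_endsD[OF assms]
  have "drop (?p - 1) S = S ! (?p - 1) # drop ?p S" using e Cons_nth_drop_Suc[of "?p - 1" S] by simp
  moreover have "S ! (?p - 1) = letter S e" using letter_prev_occ[OF e(1)] by (simp add: letter_def)
  moreover have "drop ?p S ! (e - 1 - ?p) = letter S e" "e - 1 - ?p < length (drop ?p S)"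
    using e by (auto simp: letter_def)
  then have "letter S e \<in> set (drop ?p S)" using nth_mem by metis
  ultimately show ?thesis by (simp add: subseq_singleton_left)
qed

lemma selection_if_blocks:
  assumes "subseq (concat (map (\<lambda>(x, d). replicate d x) bs)) S" "\<forall>b \<in> set bs. 2 \<le> snd b"
  shows "\<exists>C. selection S (fst ` set bs) C"
  using assms
proof (induction bs arbitrary: S)
  case (Cons b bs)
  obtain x d where b: "b = (x, d)" by (cases b)
  from Cons.prems(1) obtain S1 S2 where S: "S = S1 @ S2" and S1: "subseq (replicate d x) S1"
    and S2: "subseq (concat (map (\<lambda>(x, d). replicate d x) bs)) S2"
    by (auto simp: b dest!: list_emb_appendD)
  have "replicate d x = [x, x] @ replicate (d - 2) x"
    using Cons.prems(2) by (cases d; cases "d - 1") (auto simp: b)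
  then have "subseq [x, x] S1"
    using S1 subseq_order.order_trans[OF prefix_imp_subseq[OF prefixI]] by blast
  then obtain e where e: "e \<in> pair_ends S1" "letter S1 e = x" by (rule ex_pair_end_if_subseq)
  obtain C where C: "selection S2 (fst ` set bs) C" using Cons.IH[OF S2] Cons.prems(2) by auto
  show ?case
  proof (cases "x \<in> fst ` set bs")
    case True
    then show ?thesis
      using selection_append[OF selection_empty[of S1] C] by (auto simp: S b insert_absorb)
  next
    case False
    then show ?thesis
      using selection_append[OF selection_singleton[OF e(1)] C] e(2) by (auto simp: S b)
  qed
qed (auto intro: selection_empty)

lemma selection_take_before:
  assumes sel: "selection S B C" and e: "e \<in> C" "\<And>d. d \<in> C \<Longrightarrow> d \<le> e"
  shows "selection (take (prev_occ S e - 1) S) (B - {letter S e}) (C - {e})"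
proof -
  let ?T = "take (prev_occ S e - 1) S"
  note C = selectionD[OF sel]
  have "d \<in> {1..length ?T}" if "d \<in> C" "d \<noteq> e" for d
  proof -
    have "d \<in> interval S d" using that(1) C(1) by (blast intro: pair_end_in_interval)
    then have "d \<notin> interval S e" using disjoint_family_onD[OF C(4) that(1) e(1) that(2)] by blast
    then have "d < prev_occ S e" using e(2)[OF that(1)] by (simp add: interval_def)
    moreover have "0 < d" "d \<le> length S" using that(1) C(1) pair_endsD by blast+
    ultimately show ?thesis by auto
  qed
  then have "C - {e} \<subseteq> {1..length ?T}" by blast
  moreover have "{d \<in> C. letter S d \<in> B - {letter S e}} = C - {e}"
    using C(2,3) e(1) by (auto simp: inj_on_def)
  then have "selection S (B - {letter S e}) (C - {e})"
    using selection_restrict[OF sel, of "B - {letter S e}"] by simp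
  ultimately show ?thesis
    using selection_append_left_iff[of "C - {e}" ?T "drop (prev_occ S e - 1) S"] by simp
qed

lemma pairs_subseq_if_selection:
  assumes "selection S B C"
  shows "\<exists>xs. distinct xs \<and> set xs = B \<and> subseq (concat (map (\<lambda>x. [x, x]) xs)) S"
  using assms
proof (induction "length S" arbitrary: S B C rule: less_induct)
  case less
  note C = selectionD[OF less.prems]
  show ?case
  proof (cases "C = {}")
    case True
    then show ?thesis using C(3) by (intro exI[of _ "[]"]) simp
  next
    case False
    have "finite C" using C(1) by (rule finite_subset) (simp add: pair_ends_def)
    then obtain e where e: "e \<in> C" "\<And>d. d \<in> C \<Longrightarrow> d \<le> e" using False by (meson Max_ge Max_in)
    let ?a = "letter S e" and ?m = "prev_occ S e - 1"
    have pair_end: "e \<in> pair_ends S" using C(1) e(1) by blast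
    have "length (take ?m S) < length S" using pair_endsD[OF pair_end] by simp
    from less.hyps[OF this selection_take_before[OF less.prems e]]
    obtain xs where xs: "distinct xs" "set xs = B - {?a}"
      "subseq (concat (map (\<lambda>x. [x, x]) xs)) (take ?m S)" by blast
    have "subseq (concat (map (\<lambda>x. [x, x]) (xs @ [?a]))) (take ?m S @ drop ?m S)"
      using list_emb_append_mono[OF xs(3) subseq_if_pair_end[OF pair_end]] by simp
    moreover have "?a \<in> B" using C(3) e(1) by blast
    ultimately show ?thesis using xs by (intro exI[of _ "xs @ [?a]"]) auto
  qed
qed

theorem FT_solvable_iff_selection: "FT_solvable (\<sigma>, S) \<longleftrightarrow> (\<exists>C. selection S {..<\<sigma>} C)"
proof
  assume "FT_solvable (\<sigma>, S)"
  then obtain bs where sub: "subseq (concat (map (\<lambda>(x, d). replicate d x) bs)) S"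
    and bs: "\<forall>i < length bs. fst (bs ! i) \<in> {..<\<sigma>} \<and> snd (bs ! i) \<ge> 2"
    and all: "{..<\<sigma>} \<subseteq> set (concat (map (\<lambda>(x, d). replicate d x) bs))"
    by (auto simp: FT_solvable_def is_LDS_def letter_duplicated_def)
  have "fst ` set bs \<subseteq> {..<\<sigma>}" and long: "\<forall>b \<in> set bs. 2 \<le> snd b"
    using bs by (fastforce simp: in_set_conv_nth)+
  moreover have "set (concat (map (\<lambda>(x, d). replicate d x) bs)) \<subseteq> fst ` set bs" by force
  ultimately have "fst ` set bs = {..<\<sigma>}" using all by blast
  then show "\<exists>C. selection S {..<\<sigma>} C" using selection_if_blocks[OF sub long] by simp
next
  assume "\<exists>C. selection S {..<\<sigma>} C"
  then obtain xs where xs: "distinct xs" "set xs = {..<\<sigma>}"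
    "subseq (concat (map (\<lambda>x. [x, x]) xs)) S"
    by (metis pairs_subseq_if_selection)
  let ?w = "concat (map (\<lambda>x. [x, x]) xs)" and ?bs = "map (\<lambda>x. (x, 2 :: nat)) xs"
  have "letter_duplicated {..<\<sigma>} ?w"
    unfolding letter_duplicated_def
  proof (intro exI[of _ ?bs] conjI)
    show "?w = concat (map (\<lambda>(x, d). replicate d x) ?bs)" by (simp add: comp_def numeral_2_eq_2)
    show "\<forall>i < length ?bs. fst (?bs ! i) \<in> {..<\<sigma>} \<and> 2 \<le> snd (?bs ! i)"
      using xs(2) nth_mem[of _ xs] by auto
    show "\<forall>j. Suc j < length ?bs \<longrightarrow> fst (?bs ! j) \<noteq> fst (?bs ! Suc j)"
      using xs(1) by (simp add: nth_eq_iff_index_eq)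
  qed
  then show "FT_solvable (\<sigma>, S)" using xs by (auto simp: FT_solvable_def is_LDS_def)
qed

definition siblings :: "'a list \<Rightarrow> (nat \<times> nat) set" where
  "siblings S =
     {(d, e). d \<in> pair_ends S \<and> e \<in> pair_ends S \<and> d \<noteq> e \<and> letter S d = letter S e}"

lemma count_list_eq_card_positions:
  "count_list S a = card {k \<in> {1..length S}. letter S k = a}"
proof -
  have "{k \<in> {1..length S}. letter S k = a} = Suc ` {i. i < length S \<and> S ! i = a}"
  proof (intro equalityI subsetI)
    fix k assume "k \<in> {k \<in> {1..length S}. letter S k = a}"
    then show "k \<in> Suc ` {i. i < length S \<and> S ! i = a}" by (cases k) (auto simp: letter_def)
  qed (auto simp: letter_def)
  then show ?thesis
    by (simp add: card_image count_list_eq_length_filter length_filter_conv_card eq_commute[of a])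
qed

lemma sibling_eq_prev_occ:
  assumes "count_list S (letter S e) \<le> 3" "(d, e) \<in> siblings S" "d < e"
  shows "d = prev_occ S e"
proof (rule ccontr)
  let ?P = "{k \<in> {1..length S}. letter S k = letter S e}"
  have de: "d \<in> pair_ends S" "e \<in> pair_ends S" "letter S d = letter S e"
    using assms(2) by (auto simp: siblings_def)
  note d = pair_endsD[OF de(1)] and e = pair_endsD[OF de(2)]
  assume "d \<noteq> prev_occ S e"
  then have "d < prev_occ S e" using prev_occ_greatest[of d e S] assms(3) d de by simp
  then have "card {prev_occ S d, d, prev_occ S e, e} = 4" using d e by simp
  moreover have "{prev_occ S d, d, prev_occ S e, e} \<subseteq> ?P"
    using d e de(3) letter_prev_occ[of S d] letter_prev_occ[of S e] by auto
  then have "card {prev_occ S d, d, prev_occ S e, e} \<le> card ?P" by (intro card_mono) auto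
  ultimately show False using assms(1) by (simp add: count_list_eq_card_positions)
qed

lemma siblings_single_valued:
  assumes "\<And>a. count_list S a \<le> 3"
  shows "single_valued (siblings S)"
proof (rule single_valuedI, rule ccontr)
  fix d e e' assume siblings: "(d, e) \<in> siblings S" "(d, e') \<in> siblings S" "e \<noteq> e'"
  then have "(e, e') \<in> siblings S" by (auto simp: siblings_def)
  have less: "prev_occ S x < x" if "x \<in> {d, e, e'}" for x
    using that siblings(1,2) pair_endsD(2) by (auto simp: siblings_def)
  have adjacent: "x = prev_occ S y \<or> y = prev_occ S x" if "(x, y) \<in> siblings S" for x y
    using that assms sibling_eq_prev_occ[of S x y] sibling_eq_prev_occ[of S y x]
    by (cases x y rule: linorder_cases) (auto simp: siblings_def)
  show False
    using siblings(3) adjacent[OF siblings(1)] adjacent[OF siblings(2)]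
      adjacent[OF \<open>(e, e') \<in> siblings S\<close>] less[of d] less[of e] less[of e'] by auto
qed

lemma siblings_atMost_Suc:
  fixes i :: nat
  assumes "count_list S (letter S (Suc i)) \<le> 3" "i < length S"
  defines "p \<equiv> prev_occ S (Suc i)"
  shows "siblings S \<inter> {..Suc i} \<times> {..Suc i} = siblings S \<inter> {..i} \<times> {..i} \<union>
    (if 0 < prev_occ S p then {(Suc i, p), (p, Suc i)} else {})"
proof -
  have sibling: "(d, Suc i) \<in> siblings S \<longleftrightarrow> d = p \<and> 0 < prev_occ S p" if "d \<le> i" for d
  proof
    assume "(d, Suc i) \<in> siblings S"
    moreover from this have "d = p"
      using that assms(1) unfolding p_def by (intro sibling_eq_prev_occ) auto
    ultimately show "d = p \<and> 0 < prev_occ S p" by (auto simp: siblings_def pair_ends_def)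
  next
    assume d: "d = p \<and> 0 < prev_occ S p"
    then have "0 < p" using prev_occ_0 by (cases p) auto
    then show "(d, Suc i) \<in> siblings S"
      using d that assms(2) letter_prev_occ[of S "Suc i"]
      by (auto simp: siblings_def pair_ends_def p_def)
  qed
  have "(d, e) \<in> siblings S \<longleftrightarrow> (e, d) \<in> siblings S" "(d, d) \<notin> siblings S" for d e
    by (auto simp: siblings_def)
  moreover have "p \<le> i" using prev_occ_less[of "Suc i" S] by (simp add: p_def)
  ultimately show ?thesis using sibling by (auto simp: le_Suc_eq)
qed

lemma pair_end_cases:
  assumes "count_list S (letter S e) \<le> 3" "e \<in> pair_ends S"
  defines "l \<equiv> last_occ S (letter S e) (length S)"
  shows "e = l \<or> e = prev_occ S l"
proof -
  note e = pair_endsD[OF assms(2)]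
  have "e \<le> l" using e by (simp add: l_def last_occ_greatest)
  then have l: "letter S l = letter S e" "l \<le> length S"
    using e letter_last_occ[of S "letter S e" "length S"] last_occ_le by (auto simp: l_def)
  show ?thesis
  proof (cases "e = l")
    case False
    then have "e < l" using \<open>e \<le> l\<close> by simp
    then have "e \<le> prev_occ S l" using e l by (intro prev_occ_greatest) auto
    then have "(e, l) \<in> siblings S"
      using assms(2) e l False by (auto simp: siblings_def pair_ends_def)
    then show ?thesis using \<open>e < l\<close> assms(1) l by (auto intro: sibling_eq_prev_occ)
  qed simp
qed

section \<open>Inserting a letter into a selection\<close>

text \<open>The entry 0 of a table stands for a missing value.\<close>

definition tabulates :: "nat \<Rightarrow> (nat \<times> nat) set \<Rightarrow> (nat \<Rightarrow> nat) \<Rightarrow> bool" where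
  "tabulates n R f \<longleftrightarrow> (\<forall>k\<in>{1..n}. \<forall>e>0. f k = e \<longleftrightarrow> (k, e) \<in> R)"

definition cover :: "'a list \<Rightarrow> nat set \<Rightarrow> (nat \<times> nat) set" where
  "cover S C = {(k, e). e \<in> C \<and> k \<in> interval S e}"

definition reassigned :: "(nat \<Rightarrow> nat) \<Rightarrow> (nat \<Rightarrow> nat) \<Rightarrow> (nat \<Rightarrow> nat) \<Rightarrow> nat \<Rightarrow> nat" where
  "reassigned own new flipped k =
     (if 0 < new k then new k else if 0 < flipped (own k) then 0 else own k)"

definition excluded :: "'a list \<Rightarrow> 'a set \<Rightarrow> nat \<Rightarrow> bool" where
  "excluded S B e \<longleftrightarrow> (\<forall>C. selection S (insert (letter S e) B) C \<longrightarrow> e \<notin> C)"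

lemma tabulatesD: "tabulates n R f \<Longrightarrow> k \<in> {1..n} \<Longrightarrow> 0 < e \<Longrightarrow> f k = e \<longleftrightarrow> (k, e) \<in> R"
  by (simp add: tabulates_def)

lemma tabulates_insert:
  assumes "tabulates n R f" "f k = 0" "0 < e"
  shows "tabulates n (insert (k, e) R) (f(k := e))"
  unfolding tabulates_def
proof (intro ballI allI impI)
  fix j d :: nat assume "j \<in> {1..n}" "0 < d"
  then show "(f(k := e)) j = d \<longleftrightarrow> (j, d) \<in> insert (k, e) R"
    using tabulatesD[OF assms(1), of j d] assms(2,3) by auto
qed

lemma tabulates_eq_0: "tabulates n R f \<Longrightarrow> k \<in> {1..n} \<Longrightarrow> k \<notin> Domain R \<Longrightarrow> f k = 0"
  using tabulatesD[of n R f k "f k"] by blast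

lemma tabulates_siblings_Suc:
  fixes S :: "'a list" and i :: nat
  assumes count: "\<And>a. count_list S a \<le> 3" and i: "i < length S"
    and f: "tabulates (length S) (siblings S \<inter> {..i} \<times> {..i}) f"
  defines "p \<equiv> prev_occ S (Suc i)"
  shows "tabulates (length S) (siblings S \<inter> {..Suc i} \<times> {..Suc i})
    (if 0 < prev_occ S p then f(Suc i := p, p := Suc i) else f)"
proof (cases "0 < prev_occ S p")
  case True
  then have p: "p \<in> {1..i}" using prev_occ_less[of "Suc i" S] by (cases p) (auto simp: p_def)
  have new: "siblings S \<inter> {..Suc i} \<times> {..Suc i} =
      insert (p, Suc i) (insert (Suc i, p) (siblings S \<inter> {..i} \<times> {..i}))"
    using siblings_atMost_Suc[OF count i] True by (auto simp: p_def)
  then have "(p, Suc i) \<in> siblings S" by blast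
  then have "p \<notin> Domain (siblings S \<inter> {..i} \<times> {..i})"
    using siblings_single_valued[OF count] by (force dest: single_valuedD)
  then have "f p = 0" using p i by (intro tabulates_eq_0[OF f]) auto
  moreover have "f (Suc i) = 0" using i by (intro tabulates_eq_0[OF f]) auto
  ultimately show ?thesis
    unfolding new using True p f by (auto intro!: tabulates_insert)
qed (use siblings_atMost_Suc[OF count i] f in \<open>simp add: p_def\<close>)

lemma disjoint_if_tabulates_cover:
  assumes "D \<subseteq> pair_ends S" "tabulates (length S) (cover S D) f"
  shows "disjoint_family_on (interval S) D"
  unfolding disjoint_family_on_def
proof (intro ballI impI, rule ccontr)
  fix d e assume de: "d \<in> D" "e \<in> D" "d \<noteq> e" and "interval S d \<inter> interval S e \<noteq> {}"
  then obtain k where k: "k \<in> interval S d" "k \<in> interval S e" by blast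
  have "k \<in> {1..length S}" using k(1) de(1) assms(1) interval_subset by blast
  moreover have "0 < d" "0 < e" using de assms(1) pair_endsD(3) by blast+
  ultimately have "f k = d" "f k = e"
    using tabulatesD[OF assms(2)] de k by (simp_all add: cover_def)
  then show False using de(3) by simp
qed

lemma tabulates_cover_reassigned:
  assumes own: "tabulates n (cover S C) own" and new: "tabulates n (cover S D) new"
    and flipped: "\<And>r. r \<in> C \<Longrightarrow> 0 < flipped r \<longleftrightarrow> r \<in> F"
    and disjoint: "disjoint_family_on (interval S) (C - F \<union> D)"
    and own': "\<And>k. k \<in> {1..n} \<Longrightarrow> own' k = reassigned own new flipped k"
  shows "tabulates n (cover S (C - F \<union> D)) own'"
  unfolding tabulates_def
proof (intro ballI allI impI)
  fix k e :: nat assume k: "k \<in> {1..n}" and e: "0 < e"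
  show "own' k = e \<longleftrightarrow> (k, e) \<in> cover S (C - F \<union> D)"
  proof (cases "0 < new k")
    case True
    then have "new k \<in> D" "k \<in> interval S (new k)"
      using tabulatesD[OF new k True] by (auto simp: cover_def)
    then show ?thesis
      using True own'[OF k] disjoint_family_onD[OF disjoint, of "new k" e]
      by (auto simp: cover_def reassigned_def)
  next
    case False
    then have "(k, e) \<notin> cover S D" using tabulatesD[OF new k e] e by auto
    then have "(k, e) \<in> cover S (C - F \<union> D) \<longleftrightarrow> own k = e \<and> e \<notin> F"
      using tabulatesD[OF own k e] by (auto simp: cover_def)
    moreover have "own k = e \<Longrightarrow> 0 < flipped e \<longleftrightarrow> e \<in> F"
      using tabulatesD[OF own k e] flipped by (auto simp: cover_def)
    ultimately show ?thesis using False own'[OF k] e by (auto simp: reassigned_def)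
  qed
qed

lemma no_selection_if_excluded:
  fixes S :: "'a list" and a :: 'a
  assumes count: "\<And>a. count_list S a \<le> 3"
  defines "l \<equiv> last_occ S a (length S)"
  assumes excluded: "excluded S B l" "excluded S B (prev_occ S l)"
  shows "\<not> selection S (insert a B) C"
proof
  assume C: "selection S (insert a B) C"
  then have "a \<in> letter S ` C" using selectionD(3) by blast
  then obtain e where e: "e \<in> C" "letter S e = a" by blast
  then have "e \<in> pair_ends S" using selectionD(1)[OF C] by blast
  from pair_end_cases[OF count this] have "e = l \<or> e = prev_occ S l" by (simp add: e(2) l_def)
  then show False using excluded C e by (auto simp: excluded_def)
qed

text \<open>When the intervals \<open>ds\<close> are claimed one after the other, each from right to left, these are
  the claimed positions once the scan has reached position \<open>m\<close> of \<open>ds ! h\<close>.\<close>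

definition claims :: "'a list \<Rightarrow> nat list \<Rightarrow> nat \<Rightarrow> nat \<Rightarrow> (nat \<times> nat) set" where
  "claims S ds h m =
     cover S (set (take h ds)) \<union> {(k, ds ! h) | k. k \<in> interval S (ds ! h) \<and> m \<le> k}"

lemma claims_insert:
  "k \<in> interval S (ds ! h) \<Longrightarrow> insert (k, ds ! h) (claims S ds h (Suc k)) = claims S ds h k"
  by (auto simp: claims_def)

lemma claims_start: "claims S ds h (Suc (ds ! h)) = cover S (set (take h ds))"
  by (auto simp: claims_def interval_def)

lemma claims_finish:
  "h < length ds \<Longrightarrow> claims S ds h (prev_occ S (ds ! h)) = cover S (set (take (Suc h) ds))"
  by (auto simp: claims_def cover_def interval_def take_Suc_conv_app_nth)

lemma claims_append: "h < length ds \<Longrightarrow> claims S (ds @ es) h m = claims S ds h m"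
  by (simp add: claims_def nth_append)

lemma claims_subset_cover: "h < length ds \<Longrightarrow> claims S ds h m \<subseteq> cover S (set ds)"
  by (auto simp: claims_def cover_def dest: in_set_takeD)

lemma current_notin_claims:
  assumes "distinct ds" "h < length ds"
  shows "(k, ds ! h) \<notin> claims S ds h (Suc k)"
proof -
  have "ds ! h \<notin> set (take h ds)" using assms by (auto simp: in_set_conv_nth nth_eq_iff_index_eq)
  then show ?thesis by (auto simp: claims_def cover_def)
qed

locale insertion =
  fixes S :: "'a list" and B :: "'a set" and C :: "nat set" and e0 :: nat
  assumes selection: "selection S B C" and e0_pair_end: "e0 \<in> pair_ends S"
    and e0_new: "letter S e0 \<notin> B"
begin

definition extension :: "nat set \<Rightarrow> bool" where
  "extension C' \<longleftrightarrow> selection S (insert (letter S e0) B) C' \<and> e0 \<in> C'"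

text \<open>\<open>D\<close> is the set of the queued intervals. The last clause says that all of them are forced by
  the choice of \<open>e0\<close>.\<close>

definition displacement :: "nat set \<Rightarrow> bool" where
  "displacement D \<longleftrightarrow> e0 \<in> D \<and> D \<subseteq> pair_ends S \<and> D \<inter> C = {} \<and> inj_on (letter S) D \<and>
     letter S ` D \<subseteq> insert (letter S e0) B \<and> (\<forall>C'. extension C' \<longrightarrow> D \<subseteq> C')"

definition displaced :: "nat set \<Rightarrow> nat set" where
  "displaced D = {r \<in> C. letter S r \<in> letter S ` D}"

definition vacated :: "nat set \<Rightarrow> (nat \<times> nat) set \<Rightarrow> bool" where
  "vacated D R \<longleftrightarrow> (\<forall>(k, d)\<in>R. \<forall>r\<in>C. k \<in> interval S r \<longrightarrow> r \<in> displaced D)"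

lemmas C_selection = selectionD[OF selection]

lemma displacementD:
  assumes "displacement D"
  shows "e0 \<in> D" "D \<subseteq> pair_ends S" "D \<inter> C = {}" "inj_on (letter S) D"
    "letter S ` D \<subseteq> insert (letter S e0) B" "extension C' \<Longrightarrow> D \<subseteq> C'"
  using assms by (auto simp: displacement_def)

lemma displacement_singleton: "displacement {e0}"
  using e0_pair_end e0_new C_selection(3) by (auto simp: displacement_def extension_def)

lemma displaced_singleton: "displaced {e0} = {}"
proof -
  have "letter S r \<noteq> letter S e0" if "r \<in> C" for r
    using imageI[OF that, of "letter S"] e0_new by (auto simp: C_selection(3))
  then show ?thesis by (simp add: displaced_def)
qed

lemma excluded_if_no_extension: "(\<And>C'. \<not> extension C') \<Longrightarrow> excluded S B e0"
  by (simp add: excluded_def extension_def)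

lemma excluded_if_overlap:
  assumes "displacement D" "(k, d) \<in> cover S D" "(k, e) \<in> cover S D" "d \<noteq> e"
  shows "excluded S B e0"
proof (rule excluded_if_no_extension)
  fix C'
  show "\<not> extension C'"
  proof
    assume "extension C'"
    moreover from this have "d \<in> C'" "e \<in> C'"
      using displacementD(6)[OF assms(1)] assms(2,3) by (auto simp: cover_def)
    ultimately have "interval S d \<inter> interval S e = {}"
      using assms(4) by (auto simp: extension_def selection_def disjoint_family_on_def)
    then show False using assms(2,3) by (auto simp: cover_def)
  qed
qed

lemma extension_contains_sibling:
  assumes "displacement D" "(k, d) \<in> cover S D" "(k, r) \<in> cover S C" "extension C'"
  shows "\<exists>y\<in>C'. (r, y) \<in> siblings S"
proof -
  have d: "d \<in> D" "k \<in> interval S d" and r: "r \<in> C" "k \<in> interval S r"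
    using assms(2,3) by (auto simp: cover_def)
  have C': "C' \<subseteq> pair_ends S" "letter S ` C' = insert (letter S e0) B"
    "disjoint_family_on (interval S) C'"
    using assms(4) by (auto simp: extension_def selection_def bij_betw_def)
  have "letter S r \<in> letter S ` C'" using r(1) C_selection(3) C'(2) by blast
  then obtain y where y: "y \<in> C'" "letter S r = letter S y" by blast
  have "d \<in> C'" using displacementD(6)[OF assms(1,4)] d(1) by blast
  moreover have "d \<noteq> r" using displacementD(3)[OF assms(1)] d(1) r(1) by blast
  ultimately have "r \<notin> C'" using d(2) r(2) disjoint_family_onD[OF C'(3)] by blast
  then have "r \<noteq> y" using y(1) by blast
  then show ?thesis using y r(1) C'(1) C_selection(1) by (auto simp: siblings_def)
qed

lemma excluded_if_no_sibling:
  assumes "displacement D" "(k, d) \<in> cover S D" "(k, r) \<in> cover S C" "r \<notin> Domain (siblings S)"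
  shows "excluded S B e0"
  using extension_contains_sibling[OF assms(1-3)] assms(4) by (intro excluded_if_no_extension) blast

lemma displacement_insert:
  assumes D: "displacement D" and k: "(k, d) \<in> cover S D" "(k, r) \<in> cover S C"
    and r: "r \<notin> displaced D" and y: "(r, y) \<in> siblings S" and unique: "single_valued (siblings S)"
  shows "displacement (insert y D)"
proof -
  have rC: "r \<in> C" using k(2) by (simp add: cover_def)
  have y': "y \<in> pair_ends S" "y \<noteq> r" "letter S y = letter S r" using y by (auto simp: siblings_def)
  have "y \<notin> C" using y' rC C_selection(2) by (auto simp: inj_on_def)
  moreover have "letter S y \<in> B" using y'(3) rC C_selection(3) by auto
  moreover have "letter S y \<notin> letter S ` D" using r rC y'(3) by (simp add: displaced_def)
  then have "inj_on (letter S) (insert y D)" using displacementD(4)[OF D] by auto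
  moreover have "y \<in> C'" if "extension C'" for C'
    using extension_contains_sibling[OF D k that] y unique by (auto dest: single_valuedD)
  ultimately show ?thesis using displacementD[OF D] y'(1) by (auto simp: displacement_def)
qed

lemma displaced_insert:
  assumes "r \<in> C" "letter S y = letter S r"
  shows "displaced (insert y D) = insert r (displaced D)"
  using assms C_selection(2) by (auto simp: displaced_def inj_on_def)

lemma vacated_insert:
  assumes "vacated D R" "\<And>r. (k, r) \<in> cover S C \<Longrightarrow> r \<in> displaced D"
  shows "vacated D (insert (k, d) R)"
  using assms by (auto simp: vacated_def cover_def)

lemma vacated_mono: "vacated D R \<Longrightarrow> D \<subseteq> D' \<Longrightarrow> vacated D' R"
  by (fastforce simp: vacated_def displaced_def)

theorem selection_displacement:
  assumes D: "displacement D" "vacated D (cover S D)" "disjoint_family_on (interval S) D"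
  shows "selection S (insert (letter S e0) B) (C - displaced D \<union> D)"
proof -
  have "{r \<in> C. letter S r \<in> B - letter S ` D} = C - displaced D"
    using C_selection(3) by (auto simp: displaced_def)
  then have kept: "selection S (B - letter S ` D) (C - displaced D)"
    using selection_restrict[OF selection, of "B - letter S ` D"] by simp
  have new: "selection S (letter S ` D) D"
    using displacementD[OF D(1)] D(3) by (simp add: selection_def bij_betw_def)
  have "selection S (B - letter S ` D \<union> letter S ` D) (C - displaced D \<union> D)"
  proof (rule selection_Un[OF kept new])
    fix r d assume "r \<in> C - displaced D" "d \<in> D"
    then show "interval S r \<inter> interval S d = {}"
      using D(2) by (fastforce simp: vacated_def cover_def)
  qed blast
  moreover have "B - letter S ` D \<union> letter S ` D = insert (letter S e0) B"
    using displacementD(1,5)[OF D(1)] by blast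
  ultimately show ?thesis by simp
qed

end

section \<open>A while language with arrays\<close>

datatype 'v expr = Zero | Var 'v | Succ 'v | Pred 'v | Minus 'v 'v

datatype ('v, 'f) com =
    Skip
  | Assign 'v "'v expr" (infix "::=" 65)
  | Get 'v 'f 'v
  | Put 'f 'v 'v
  | Input 'v
  | Seq "('v, 'f) com" "('v, 'f) com" (infixr ";;" 60)
  | IfPos 'v "('v, 'f) com" "('v, 'f) com"
  | WhilePos 'v "('v, 'f) com"

record ('v, 'f) state =
  vars :: "'v \<Rightarrow> nat"
  arrs :: "'f \<Rightarrow> nat \<Rightarrow> nat"
  input :: "nat list"

primrec val :: "'v expr \<Rightarrow> ('v \<Rightarrow> nat) \<Rightarrow> nat" where
  "val Zero V = 0"
| "val (Var y) V = V y"
| "val (Succ y) V = V y + 1"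
| "val (Pred y) V = V y - 1"
| "val (Minus y z) V = V y - V z"

abbreviation set_var :: "'v \<Rightarrow> nat \<Rightarrow> ('v, 'f) state \<Rightarrow> ('v, 'f) state" where
  "set_var x n s \<equiv> s\<lparr>vars := (vars s)(x := n)\<rparr>"

abbreviation set_entry :: "'f \<Rightarrow> nat \<Rightarrow> nat \<Rightarrow> ('v, 'f) state \<Rightarrow> ('v, 'f) state" where
  "set_entry f k n s \<equiv> s\<lparr>arrs := (arrs s)(f := (arrs s f)(k := n))\<rparr>"

abbreviation next_input :: "('v, 'f) state \<Rightarrow> nat" where
  "next_input s \<equiv> case input s of [] \<Rightarrow> 0 | i # _ \<Rightarrow> i"

inductive big_step :: "('v, 'f) com \<Rightarrow> ('v, 'f) state \<Rightarrow> nat \<Rightarrow> ('v, 'f) state \<Rightarrow> bool" where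
  Skip: "big_step Skip s 0 s"
| Assign: "big_step (x ::= e) s 1 (set_var x (val e (vars s)) s)"
| Get: "big_step (Get x f y) s 1 (set_var x (arrs s f (vars s y)) s)"
| Put: "big_step (Put f y x) s 1 (set_entry f (vars s y) (vars s x) s)"
| Input: "big_step (Input x) s 1 (set_var x (next_input s) s\<lparr>input := tl (input s)\<rparr>)"
| Seq: "big_step c s t s' \<Longrightarrow> big_step d s' t' s'' \<Longrightarrow> big_step (c ;; d) s (t + t') s''"
| IfPos: "0 < vars s x \<Longrightarrow> big_step c s t s' \<Longrightarrow> big_step (IfPos x c d) s (Suc t) s'"
| IfZero: "vars s x = 0 \<Longrightarrow> big_step d s t s' \<Longrightarrow> big_step (IfPos x c d) s (Suc t) s'"
| WhilePos: "0 < vars s x \<Longrightarrow> big_step c s t s' \<Longrightarrow> big_step (WhilePos x c) s' t' s'' \<Longrightarrow>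
    big_step (WhilePos x c) s (Suc (t + t')) s''"
| WhileZero: "vars s x = 0 \<Longrightarrow> big_step (WhilePos x c) s 1 s"

inductive_simps big_step_simps:
  "big_step Skip s t s'" "big_step (x ::= e) s t s'" "big_step (Get x f y) s t s'"
  "big_step (Put f y x) s t s'" "big_step (Input x) s t s'" "big_step (c ;; d) s t s'"
  "big_step (IfPos x c d) s t s'"

primrec assigned :: "('v, 'f) com \<Rightarrow> 'v set" where
  "assigned Skip = {}"
| "assigned (x ::= e) = {x}"
| "assigned (Get x f y) = {x}"
| "assigned (Put f y x) = {}"
| "assigned (Input x) = {x}"
| "assigned (c ;; d) = assigned c \<union> assigned d"
| "assigned (IfPos x c d) = assigned c \<union> assigned d"
| "assigned (WhilePos x c) = assigned c"

primrec stored :: "('v, 'f) com \<Rightarrow> 'f set" where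
  "stored Skip = {}"
| "stored (x ::= e) = {}"
| "stored (Get x f y) = {}"
| "stored (Put f y x) = {f}"
| "stored (Input x) = {}"
| "stored (c ;; d) = stored c \<union> stored d"
| "stored (IfPos x c d) = stored c \<union> stored d"
| "stored (WhilePos x c) = stored c"

definition frame :: "('v, 'f) com \<Rightarrow> ('v, 'f) state \<Rightarrow> ('v, 'f) state \<Rightarrow> bool" where
  "frame c s s' \<longleftrightarrow> (\<forall>x. x \<notin> assigned c \<longrightarrow> vars s' x = vars s x) \<and>
     (\<forall>f. f \<notin> stored c \<longrightarrow> arrs s' f = arrs s f)"

lemma big_step_frame: "big_step c s t s' \<Longrightarrow> frame c s s'"
  by (induction rule: big_step.induct) (auto simp: frame_def)

lemma frame_refl: "frame c s s"
  by (simp add: frame_def)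

lemma frame_trans: "frame c s s' \<Longrightarrow> frame c s' s'' \<Longrightarrow> frame c s s''"
  by (simp add: frame_def)

text \<open>The last argument of a postcondition is the time at which it is evaluated.\<close>

definition wp ::
  "('v, 'f) com \<Rightarrow> (('v, 'f) state \<Rightarrow> nat \<Rightarrow> bool) \<Rightarrow> ('v, 'f) state \<Rightarrow> nat \<Rightarrow> bool" where
  "wp c Q s t \<longleftrightarrow> (\<exists>u s'. big_step c s u s' \<and> Q s' (t + u))"

lemma wp_Skip: "wp Skip Q s t \<longleftrightarrow> Q s t"
  by (simp add: wp_def big_step_simps)

lemma wp_Assign: "wp (x ::= e) Q s t \<longleftrightarrow> Q (set_var x (val e (vars s)) s) (t + 1)"
  by (simp add: wp_def big_step_simps)

lemma wp_Get: "wp (Get x f y) Q s t \<longleftrightarrow> Q (set_var x (arrs s f (vars s y)) s) (t + 1)"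
  by (simp add: wp_def big_step_simps)

lemma wp_Put: "wp (Put f y x) Q s t \<longleftrightarrow> Q (set_entry f (vars s y) (vars s x) s) (t + 1)"
  by (simp add: wp_def big_step_simps)

lemma wp_Input:
  "wp (Input x) Q s t \<longleftrightarrow> Q (set_var x (next_input s) s\<lparr>input := tl (input s)\<rparr>) (t + 1)"
  by (simp add: wp_def big_step_simps)

lemma wp_Seq: "wp (c ;; d) Q s t \<longleftrightarrow> wp c (wp d Q) s t"
  unfolding wp_def big_step_simps by (metis add.assoc)

lemma wp_IfPos: "wp (IfPos x c d) Q s t \<longleftrightarrow> wp (if 0 < vars s x then c else d) Q s (t + 1)"
  unfolding wp_def big_step_simps
  by (cases "vars s x = 0") (simp_all, (metis add_Suc_right)+)

lemmas wp_simps = wp_Skip wp_Assign wp_Get wp_Put wp_Input wp_Seq wp_IfPos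

lemma wp_conseq:
  assumes "wp c Q s t" "\<And>s' t'. frame c s s' \<Longrightarrow> Q s' t' \<Longrightarrow> Q' s' t'"
  shows "wp c Q' s t"
  using assms big_step_frame unfolding wp_def by blast

lemma wp_WhilePos:
  fixes n :: nat
  assumes init: "I n s t"
    and body: "\<And>m s' t'. frame c s s' \<Longrightarrow> I m s' t' \<Longrightarrow> 0 < vars s' x \<Longrightarrow>
      wp c (\<lambda>s'' t''. \<exists>l<m. I l s'' (Suc t'')) s' t'"
    and exit: "\<And>m s' t'. I m s' t' \<Longrightarrow> vars s' x = 0 \<Longrightarrow> Q s' (Suc t')"
  shows "wp (WhilePos x c) Q s t"
proof -
  have "wp (WhilePos x c) Q s' t'" if "frame c s s'" "I m s' t'" for m s' t'
    using that
  proof (induction m arbitrary: s' t' rule: less_induct)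
    case (less m)
    show ?case
    proof (cases "0 < vars s' x")
      case True
      from body[OF less.prems True] obtain u s'' l
        where step: "big_step c s' u s''" and l: "l < m" "I l s'' (Suc (t' + u))"
        unfolding wp_def by blast
      have "frame c s s''" using frame_trans[OF less.prems(1) big_step_frame[OF step]] .
      from less.IH[OF l(1) this l(2)] obtain u' s'''
        where rest: "big_step (WhilePos x c) s'' u' s'''" "Q s''' (Suc (t' + u) + u')"
        unfolding wp_def by blast
      then show ?thesis
        using big_step.WhilePos[of s' x, OF True step rest(1)] unfolding wp_def
        by (metis add_Suc add_Suc_right add.assoc)
    next
      case False
      then show ?thesis
        using exit[OF less.prems(2)] big_step.WhileZero[of s' x c] unfolding wp_def by fastforce
    qed
  qed
  then show ?thesis using init frame_refl by blast
qed

definition countdown :: "'v \<Rightarrow> ('v, 'f) com \<Rightarrow> ('v, 'f) com" where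
  "countdown x c = WhilePos x (c ;; x ::= Pred x)"

lemma wp_countdown:
  assumes x: "x \<notin> assigned c" "vars s x = n" and init: "I n s"
    and body: "\<And>k s' t'. k < n \<Longrightarrow> frame (countdown x c) s s' \<Longrightarrow> I (Suc k) s' \<Longrightarrow>
      vars s' x = Suc k \<Longrightarrow> wp c (\<lambda>s'' t''. I k (set_var x k s'') \<and> t'' \<le> t' + K) s' t'"
  shows "wp (countdown x c) (\<lambda>s' t'. I 0 s' \<and> t' \<le> t + (K + 2) * n + 1) s t"
proof -
  define J where "J k s' t' \<longleftrightarrow> k \<le> n \<and> I k s' \<and> vars s' x = k \<and>
    t' + (K + 2) * k \<le> t + (K + 2) * n" for k s' t'
  show ?thesis
    unfolding countdown_def
  proof (rule wp_WhilePos[where I = J])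
    show "J n s t" using x(2) init by (simp add: J_def)
  next
    fix m s' t'
    assume frame: "frame (c ;; x ::= Pred x) s s'" and J: "J m s' t'" and "0 < vars s' x"
    then obtain k where m: "m = Suc k" by (auto simp: J_def gr0_conv_Suc)
    have "wp c (\<lambda>s'' t''. I k (set_var x k s'') \<and> t'' \<le> t' + K) s' t'"
      using J frame by (intro body) (auto simp: J_def m frame_def countdown_def)
    then have "wp c (\<lambda>s'' t''. J k (set_var x (vars s'' x - 1) s'') (Suc (Suc t''))) s' t'"
      by (rule wp_conseq) (use J x(1) in \<open>auto simp: J_def m frame_def\<close>)
    then show "wp (c ;; x ::= Pred x) (\<lambda>s'' t''. \<exists>l<m. J l s'' (Suc t'')) s' t'"
      unfolding wp_Seq wp_Assign by (rule wp_conseq) (auto simp: m)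
  next
    fix m s' t'
    assume "J m s' t'" "vars s' x = 0"
    then show "I 0 s' \<and> Suc t' \<le> t + (K + 2) * n + 1" by (auto simp: J_def)
  qed
qed

definition values_le :: "nat \<Rightarrow> ('v, 'f) state \<Rightarrow> bool" where
  "values_le m s \<longleftrightarrow> (\<forall>x. vars s x \<le> m) \<and> (\<forall>f k. arrs s f k \<le> m) \<and> (\<forall>i\<in>set (input s). i \<le> m)"

lemma values_le_mono: "values_le m s \<Longrightarrow> m \<le> n \<Longrightarrow> values_le n s"
  unfolding values_le_def by (meson le_trans)

lemma val_le: "(\<And>x. V x \<le> m) \<Longrightarrow> val e V \<le> Suc m"
  by (cases e) (auto intro: le_SucI le_trans[OF diff_le_self])

lemma next_input_le: "values_le m s \<Longrightarrow> next_input s \<le> m"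
  by (auto simp: values_le_def split: list.split)

lemma big_step_values_le: "big_step c s t s' \<Longrightarrow> values_le m s \<Longrightarrow> values_le (m + t) s'"
proof (induction arbitrary: m rule: big_step.induct)
  case (Assign x e s)
  then show ?case using val_le[of "vars s" m e] by (auto simp: values_le_def le_SucI)
next
  case (Input x s)
  then show ?case by (cases "input s") (auto simp: values_le_def le_SucI)
next
  case (Seq c s t s' d t' s'')
  then show ?case by (metis add.assoc)
next
  case (WhilePos s x c t s' t' s'')
  then have "values_le (m + t + t') s''" by blast
  then show ?case by (rule values_le_mono) simp
qed (auto simp: values_le_def le_SucI intro: values_le_mono)

section \<open>Compilation to random access machines\<close>

definition runs :: "instr list \<Rightarrow> nat \<Rightarrow> config \<Rightarrow> nat \<Rightarrow> config \<Rightarrow> bool" where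
  "runs p b c t c' \<longleftrightarrow> (step p ^^ t) c = c' \<and> (\<forall>u\<le>t. \<forall>i. reg ((step p ^^ u) c) i \<le> b)"

lemma runs_0: "(\<And>i. X i \<le> b) \<Longrightarrow> runs p b (a, X, inp) 0 (a, X, inp)"
  by (simp add: runs_def reg_def)

lemma runs_trans:
  assumes "runs p b c t c'" "runs p b c' t' c''"
  shows "runs p b c (t + t') c''"
  unfolding runs_def
proof (intro conjI allI impI)
  have later: "(step p ^^ (t + u)) c = (step p ^^ u) c'" for u
    using assms(1) by (simp add: runs_def funpow_add add.commute[of t])
  show "(step p ^^ (t + t')) c = c''" using assms(2) by (simp only: later) (simp add: runs_def)
  fix u i assume "u \<le> t + t'"
  show "reg ((step p ^^ u) c) i \<le> b"
  proof (cases "u \<le> t")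
    case False
    then have "u = t + (u - t)" "u - t \<le> t'" using \<open>u \<le> t + t'\<close> by auto
    then show ?thesis using assms(2) later[of "u - t"] by (simp add: runs_def)
  qed (use assms(1) in \<open>simp add: runs_def\<close>)
qed

lemma runs_exec:
  assumes "a < length p" "\<And>i. X i \<le> b" "runs p b (exec (p ! a) (a, X, inp)) t c"
  shows "runs p b (a, X, inp) (Suc t) c"
proof -
  have "step p (a, X, inp) = exec (p ! a) (a, X, inp)"
    using assms(1) by (simp add: step_def halted_def)
  moreover from this have "reg (exec (p ! a) (a, X, inp)) i \<le> b" for i
    using assms(3) unfolding runs_def by (metis funpow_0 le0)
  ultimately have "runs p b (a, X, inp) 1 (exec (p ! a) (a, X, inp))"
    using assms(2) by (auto simp: runs_def reg_def le_Suc_eq)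
  from runs_trans[OF this assms(3)] show ?thesis by simp
qed

definition code_at :: "instr list \<Rightarrow> nat \<Rightarrow> instr list \<Rightarrow> bool" where
  "code_at p a is \<longleftrightarrow> prefix is (drop a p)"

lemma code_at_Nil [simp]: "code_at p a []"
  by (simp add: code_at_def)

lemma code_at_Cons [simp]:
  "code_at p a (i # is) \<longleftrightarrow> a < length p \<and> p ! a = i \<and> code_at p (Suc a) is"
proof (cases "a < length p")
  case True
  then show ?thesis by (auto simp: code_at_def simp flip: Cons_nth_drop_Suc)
qed (simp add: code_at_def)

lemma code_at_append [simp]:
  "code_at p a (is @ js) \<longleftrightarrow> code_at p a is \<and> code_at p (a + length is) js"
  by (induction "is" arbitrary: a) auto

lemma runs_doublings:
  assumes "code_at p a (replicate n (Add r r r))" "\<And>j. X j \<le> b" "2 ^ n * X r \<le> b"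
  shows "runs p b (a, X, inp) n (a + n, X(r := 2 ^ n * X r), inp)"
  using assms
proof (induction n arbitrary: a X)
  case 0
  then show ?case by (simp add: runs_0)
next
  case (Suc n)
  let ?X = "X(r := 2 * X r)"
  have "2 * X r \<le> 2 ^ n * (2 * X r)" using mult_right_mono[of 1 "2 ^ n" "2 * X r"] by simp
  also have "\<dots> \<le> b" using Suc.prems(3) by (simp add: ac_simps)
  finally have "runs p b (Suc a, ?X, inp) n (Suc a + n, ?X(r := 2 ^ n * ?X r), inp)"
    by (intro Suc.IH) (use Suc.prems in \<open>simp_all add: ac_simps\<close>)
  moreover have "exec (p ! a) (a, X, inp) = (Suc a, ?X, inp)"
    using Suc.prems(1) by (simp add: mult_2)
  moreover have "?X(r := 2 ^ n * ?X r) = X(r := 2 ^ Suc n * X r)" by (simp add: ac_simps)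
  ultimately show ?case
    using Suc.prems(1,2)
    by (intro runs_exec) (simp_all only: code_at_Cons replicate_Suc add_Suc_shift)
qed

lemma runs_instr:
  assumes "code_at p a [i]" "exec i (a, X, inp) = (a', X', inp')" "\<And>j. X j \<le> b" "\<And>j. X' j \<le> b"
  shows "runs p b (a, X, inp) 1 (a', X', inp')"
  using runs_exec[of a p X b inp 0] assms runs_0[of X' b p a' inp'] by simp

lemma runs_two_instrs:
  assumes "code_at p a [i, j]" "exec i (a, X, inp) = (a + 1, X', inp')"
    "exec j (a + 1, X', inp') = (a'', X'', inp'')"
    "\<And>k. X k \<le> b" "\<And>k. X' k \<le> b" "\<And>k. X'' k \<le> b"
  shows "runs p b (a, X, inp) 2 (a'', X'', inp'')"
proof -
  have "runs p b (a, X, inp) 1 (a + 1, X', inp')" "runs p b (a + 1, X', inp') 1 (a'', X'', inp'')"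
    by (rule runs_instr[of p a i] runs_instr[of p "a + 1" j]; use assms in simp)+
  from runs_trans[OF this] show ?thesis by (simp add: numeral_2_eq_2)
qed

text \<open>The scalar variables and two scratch registers live below address \<open>2 ^ w\<close>, and the arrays are
  interleaved above.\<close>

locale layout =
  fixes reg_of :: "'v \<Rightarrow> nat" and slot_of :: "'f \<Rightarrow> nat" and w :: nat
  assumes inj_reg_of: "inj reg_of" and reg_of_less: "reg_of x + 2 < 2 ^ w"
    and inj_slot_of: "inj slot_of" and slot_of_less: "slot_of f < 2 ^ w"
begin

definition tmp :: nat where
  "tmp = 2 ^ w - 2"

definition tmp' :: nat where
  "tmp' = 2 ^ w - 1"

definition address :: "'f \<Rightarrow> nat \<Rightarrow> nat" where
  "address f k = 2 ^ w * (k + 1) + slot_of f"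

lemma address_eq_iff: "address f k = address g l \<longleftrightarrow> f = g \<and> k = l"
proof
  assume eq: "address f k = address g l"
  have "address f k div 2 ^ w = k + 1" "address f k mod 2 ^ w = slot_of f" for f k
    using slot_of_less[of f] unfolding address_def by (subst div_mult_self4 mod_mult_self4; simp)+
  with eq have "slot_of f = slot_of g" "k = l" by (metis, metis add_right_cancel)
  then show "f = g \<and> k = l" using inj_slot_of by (simp add: inj_eq)
qed simp

lemma address_ge: "2 ^ w \<le> address f k"
  by (simp add: address_def)

definition capacity :: "nat \<Rightarrow> nat" where
  "capacity n = 2 ^ w * (n + 2)"

lemma le_capacity: "k \<le> n + 2 \<Longrightarrow> k \<le> capacity n"
  using mult_right_mono[of 1 "2 ^ w" "n + 2"] by (simp add: capacity_def)

lemma address_le_capacity: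
  assumes "k \<le> n"
  shows "address f k \<le> capacity n"
proof -
  have "address f k \<le> 2 ^ w * (k + 1) + 2 ^ w"
    using slot_of_less[of f] by (simp add: address_def)
  also have "\<dots> = 2 ^ w * (k + 2)" by simp
  also have "\<dots> \<le> capacity n" unfolding capacity_def using assms by (intro mult_left_mono) simp_all
  finally show ?thesis .
qed

lemma registers_distinct:
  "reg_of x \<noteq> tmp" "reg_of x \<noteq> tmp'" "tmp \<noteq> tmp'" "reg_of x \<noteq> address f k"
  "address f k \<noteq> tmp" "address f k \<noteq> tmp'"
  using reg_of_less[of x] address_ge[of f k] by (auto simp: tmp_def tmp'_def)

lemmas registers_eq_simps =
  registers_distinct registers_distinct[symmetric] inj_eq[OF inj_reg_of] address_eq_iff

definition represents :: "nat \<Rightarrow> (nat \<Rightarrow> nat) \<Rightarrow> ('v, 'f) state \<Rightarrow> bool" where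
  "represents b X s \<longleftrightarrow> (\<forall>x. X (reg_of x) = vars s x) \<and>
     (\<forall>f k. X (address f k) = arrs s f k) \<and> (\<forall>j. X j \<le> b)"

lemma representsD:
  assumes "represents b X s"
  shows "X (reg_of x) = vars s x" "X (address f k) = arrs s f k" "X j \<le> b"
  using assms by (auto simp: represents_def)

lemma represents_scratch:
  "represents b X s \<Longrightarrow> j \<in> {tmp, tmp'} \<Longrightarrow> n \<le> b \<Longrightarrow> represents b (X(j := n)) s"
  by (auto simp: represents_def registers_eq_simps)

lemma represents_set_var:
  "represents b X s \<Longrightarrow> n \<le> b \<Longrightarrow> represents b (X(reg_of x := n)) (set_var x n s)"
  by (auto simp: represents_def registers_eq_simps)

lemma represents_set_entry:
  "represents b X s \<Longrightarrow> n \<le> b \<Longrightarrow> represents b (X(address f k := n)) (set_entry f k n s)"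
  by (auto simp: represents_def registers_eq_simps)

primrec expr_code :: "nat \<Rightarrow> 'v expr \<Rightarrow> instr list" where
  "expr_code r Zero = [Const tmp 0, Add r tmp tmp]"
| "expr_code r (Var y) = [Const tmp 0, Add r (reg_of y) tmp]"
| "expr_code r (Succ y) = [Const tmp 1, Add r (reg_of y) tmp]"
| "expr_code r (Pred y) = [Const tmp 1, Sub r (reg_of y) tmp]"
| "expr_code r (Minus y z) = [Const tmp 0, Sub r (reg_of y) (reg_of z)]"

definition address_code :: "'f \<Rightarrow> 'v \<Rightarrow> instr list" where
  "address_code f y = [Const tmp 1, Add tmp (reg_of y) tmp] @ replicate w (Add tmp tmp tmp) @
     [Const tmp' (slot_of f), Add tmp tmp tmp']"

definition goto_code :: "nat \<Rightarrow> instr list" where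
  "goto_code l = [Const tmp 1, JumpPos tmp l]"

fun compile :: "('v, 'f) com \<Rightarrow> nat \<Rightarrow> instr list" where
  "compile Skip a = []"
| "compile (x ::= e) a = expr_code (reg_of x) e"
| "compile (Get x f y) a = address_code f y @ [Load (reg_of x) tmp]"
| "compile (Put f y x) a = address_code f y @ [Store tmp (reg_of x)]"
| "compile (Input x) a = [Read (reg_of x)]"
| "compile (c ;; d) a = compile c a @ compile d (a + length (compile c a))"
| "compile (IfPos x c d) a =
     (let else_code = compile d (a + 1); l = a + length else_code + 3; then_code = compile c l
      in JumpPos (reg_of x) l # else_code @ goto_code (l + length then_code) @ then_code)"
| "compile (WhilePos x c) a =
     (let body = compile c (a + 3)
      in JumpPos (reg_of x) (a + 3) # goto_code (a + length body + 5) @ body @ goto_code a)"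

definition simulated ::
  "instr list \<Rightarrow> nat \<Rightarrow> nat \<Rightarrow> ('v, 'f) state \<Rightarrow> nat \<Rightarrow> nat \<Rightarrow> ('v, 'f) state \<Rightarrow> bool" where
  "simulated p b a s t a' s' \<longleftrightarrow> (\<forall>X. represents b X s \<longrightarrow>
     (\<exists>u\<le>t. \<exists>X'. runs p b (a, X, input s) u (a', X', input s') \<and> represents b X' s'))"

lemma simulated_mono: "simulated p b a s t a' s' \<Longrightarrow> t \<le> t' \<Longrightarrow> simulated p b a s t' a' s'"
  unfolding simulated_def by (meson le_trans)

lemma simulatedI:
  assumes "\<And>X. represents b X s \<Longrightarrow> runs p b (a, X, input s) t (a', f X, input s')"
    and "\<And>X. represents b X s \<Longrightarrow> represents b (f X) s'"
  shows "simulated p b a s t a' s'"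
  using assms unfolding simulated_def by blast

lemma simulated_refl: "simulated p b a s 0 a s"
  by (rule simulatedI[where f = "\<lambda>X. X"]) (auto intro: runs_0 representsD)

lemma simulated_trans:
  assumes "simulated p b a s t a' s'" "simulated p b a' s' t' a'' s''"
  shows "simulated p b a s (t + t') a'' s''"
  unfolding simulated_def
proof (intro allI impI)
  fix X assume "represents b X s"
  then obtain u X' where u: "u \<le> t" "runs p b (a, X, input s) u (a', X', input s')"
    "represents b X' s'"
    using assms(1) unfolding simulated_def by blast
  then obtain u' X'' where u': "u' \<le> t'" "runs p b (a', X', input s') u' (a'', X'', input s'')"
    "represents b X'' s''"
    using assms(2) unfolding simulated_def by blast
  from u u' show "\<exists>u\<le>t + t'. \<exists>X'. runs p b (a, X, input s) u (a'', X', input s'') \<and>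
      represents b X' s''"
    by (meson add_mono runs_trans)
qed

lemma simulated_jump:
  assumes "code_at p a [JumpPos (reg_of x) l]"
  shows "0 < vars s x \<Longrightarrow> simulated p b a s 1 l s" "vars s x = 0 \<Longrightarrow> simulated p b a s 1 (a + 1) s"
proof -
  have "simulated p b a s 1 (if 0 < vars s x then l else a + 1) s"
  proof (rule simulatedI[where f = "\<lambda>X. X"])
    fix X assume X: "represents b X s"
    show "runs p b (a, X, input s) 1 (if 0 < vars s x then l else a + 1, X, input s)"
      by (rule runs_instr[OF assms]) (simp_all add: representsD[OF X])
  qed
  then show "0 < vars s x \<Longrightarrow> simulated p b a s 1 l s"
    "vars s x = 0 \<Longrightarrow> simulated p b a s 1 (a + 1) s" by simp_all
qed

lemma simulated_goto:
  assumes "code_at p a (goto_code l)"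
  shows "simulated p (capacity n) a s 2 l s"
proof (rule simulatedI[where f = "\<lambda>X. X(tmp := 1)"])
  fix X assume X: "represents (capacity n) X s"
  have one: "1 \<le> capacity n" by (rule le_capacity) simp
  then show "represents (capacity n) (X(tmp := 1)) s" using X by (intro represents_scratch) auto
  show "runs p (capacity n) (a, X, input s) 2 (l, X(tmp := 1), input s)"
    by (rule runs_two_instrs[OF assms[unfolded goto_code_def], where X' = "X(tmp := 1)"])
      (use one in \<open>simp_all add: representsD[OF X]\<close>)
qed

lemma length_address_code: "length (address_code f y) = w + 4"
  by (simp add: address_code_def)

lemma runs_address_code:
  assumes X: "represents b X s" and code: "code_at p a (address_code f y)"
    and b: "address f (vars s y) \<le> b"
  obtains X' where "runs p b (a, X, inp) (w + 4) (a + (w + 4), X', inp)"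
    "represents b X' s" "X' tmp = address f (vars s y)"
proof -
  let ?n = "vars s y + 1"
  let ?X1 = "X(tmp := ?n)" and ?X2 = "X(tmp := 2 ^ w * ?n)"
  let ?X3 = "?X2(tmp' := slot_of f, tmp := address f (vars s y))"
  have code: "code_at p a [Const tmp 1, Add tmp (reg_of y) tmp]"
    "code_at p (a + 2) (replicate w (Add tmp tmp tmp))"
    "code_at p (a + 2 + w) [Const tmp' (slot_of f), Add tmp tmp tmp']"
    using code by (simp_all add: address_code_def)
  have scaled: "2 ^ w * ?n \<le> b" "slot_of f \<le> b" using b by (simp_all add: address_def)
  moreover have "?n \<le> 2 ^ w * ?n" using mult_right_mono[of 1 "2 ^ w" ?n] by simp
  ultimately have n: "?n \<le> b" by linarith
  then have "runs p b (a, X, inp) 2 (a + 2, ?X1, inp)"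
    by (intro runs_two_instrs[OF code(1), where X' = "X(tmp := 1)"])
      (simp_all add: representsD[OF X] registers_eq_simps)
  moreover have "runs p b (a + 2, ?X1, inp) w (a + 2 + w, ?X2, inp)"
    using runs_doublings[OF code(2), of ?X1 b inp] n scaled by (simp add: representsD[OF X])
  moreover have "runs p b (a + 2 + w, ?X2, inp) 2 (a + 2 + w + 2, ?X3, inp)"
    by (intro runs_two_instrs[OF code(3), where X' = "?X2(tmp' := slot_of f)"])
      (use b scaled in
        \<open>simp_all add: representsD[OF X] address_def registers_eq_simps fun_upd_twist\<close>)
  ultimately have "runs p b (a, X, inp) (2 + (w + 2)) (a + 2 + w + 2, ?X3, inp)"
    by (blast intro: runs_trans)
  moreover have "2 + (w + 2) = w + 4" "a + 2 + w + 2 = a + (w + 4)" by simp_all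
  ultimately have "runs p b (a, X, inp) (w + 4) (a + (w + 4), ?X3, inp)" by metis
  moreover have "represents b ?X3 s" using X b scaled by (intro represents_scratch) auto
  ultimately show ?thesis using that[of ?X3] by simp
qed

definition executes ::
  "instr list \<Rightarrow> nat \<Rightarrow> ('v, 'f) com \<Rightarrow> ('v, 'f) state \<Rightarrow> nat \<Rightarrow> ('v, 'f) state \<Rightarrow> bool" where
  "executes p n c s t s' \<longleftrightarrow> (\<forall>a. code_at p a (compile c a) \<longrightarrow>
     simulated p (capacity n) a s t (a + length (compile c a)) s')"

lemma executesD:
  "executes p n c s t s' \<Longrightarrow> code_at p a (compile c a) \<Longrightarrow>
    simulated p (capacity n) a s t (a + length (compile c a)) s'"
  by (simp add: executes_def)

lemma executes_mono: "executes p n c s t s' \<Longrightarrow> t \<le> t' \<Longrightarrow> executes p n c s t' s'"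
  unfolding executes_def using simulated_mono by blast

lemma executes_Skip: "executes p n Skip s 0 s"
  by (simp add: executes_def simulated_refl)

lemma executes_Assign:
  assumes "values_le n s"
  shows "executes p n (x ::= e) s 2 (set_var x (val e (vars s)) s)"
proof -
  let ?v = "val e (vars s)"
  define lit :: nat where "lit = (case e of Succ _ \<Rightarrow> 1 | Pred _ \<Rightarrow> 1 | _ \<Rightarrow> 0)"
  obtain i where code: "expr_code (reg_of x) e = [Const tmp lit, i]"
    by (cases e) (simp_all add: lit_def)
  have "?v \<le> n + 1" using assms val_le[of "vars s" n] by (simp add: values_le_def)
  then have v: "?v \<le> capacity n" by (intro le_capacity) simp
  have lit: "lit \<le> capacity n" by (intro le_capacity) (cases e; simp add: lit_def)
  have "simulated p (capacity n) a s 2 (a + 2) (set_var x ?v s)"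
    if "code_at p a [Const tmp lit, i]" for a
  proof (rule simulatedI[where f = "\<lambda>X. X(tmp := lit, reg_of x := ?v)"])
    fix X assume X: "represents (capacity n) X s"
    have "exec i (a + 1, X(tmp := lit), input s) = (a + 2, X(tmp := lit, reg_of x := ?v), input s)"
      using code by (cases e) (auto simp: lit_def representsD[OF X] registers_eq_simps)
    then show "runs p (capacity n) (a, X, input s) 2
        (a + 2, X(tmp := lit, reg_of x := ?v), input (set_var x ?v s))"
      by (intro runs_two_instrs[OF that, where X' = "X(tmp := lit)"])
        (use lit v in \<open>simp_all add: representsD[OF X]\<close>)
    show "represents (capacity n) (X(tmp := lit, reg_of x := ?v)) (set_var x ?v s)"
      using X lit v by (intro represents_set_var represents_scratch) auto
  qed
  then show ?thesis by (simp add: executes_def code)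
qed

lemma executes_Get:
  assumes "values_le n s"
  shows "executes p n (Get x f y) s (w + 5) (set_var x (arrs s f (vars s y)) s)"
  unfolding executes_def simulated_def
proof (intro allI impI exI[of _ "w + 5"] conjI)
  let ?v = "arrs s f (vars s y)"
  fix a X assume "code_at p a (compile (Get x f y) a)" and X: "represents (capacity n) X s"
  then have code: "code_at p a (address_code f y)" "code_at p (a + (w + 4)) [Load (reg_of x) tmp]"
    by (simp_all add: length_address_code)
  obtain X' where X': "runs p (capacity n) (a, X, input s) (w + 4) (a + (w + 4), X', input s)"
    "represents (capacity n) X' s" "X' tmp = address f (vars s y)"
    using runs_address_code[OF X code(1) address_le_capacity[of "vars s y" n]] assms
    by (auto simp: values_le_def)
  have v: "?v \<le> capacity n" using representsD(2,3)[OF X] by metis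
  have "runs p (capacity n) (a + (w + 4), X', input s) 1 (a + (w + 5), X'(reg_of x := ?v), input s)"
    by (rule runs_instr[OF code(2)]) (use v X'(3) in \<open>simp_all add: representsD[OF X'(2)]\<close>)
  from runs_trans[OF X'(1) this] represents_set_var[OF X'(2) v]
  show "\<exists>X'. runs p (capacity n) (a, X, input s) (w + 5)
        (a + length (compile (Get x f y) a), X', input (set_var x ?v s)) \<and>
      represents (capacity n) X' (set_var x ?v s)"
    by (auto simp: length_address_code ac_simps)
qed simp

lemma executes_Put:
  assumes "values_le n s"
  shows "executes p n (Put f y x) s (w + 5) (set_entry f (vars s y) (vars s x) s)"
  unfolding executes_def simulated_def
proof (intro allI impI exI[of _ "w + 5"] conjI)
  let ?s = "set_entry f (vars s y) (vars s x) s"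
  fix a X assume "code_at p a (compile (Put f y x) a)" and X: "represents (capacity n) X s"
  then have code: "code_at p a (address_code f y)" "code_at p (a + (w + 4)) [Store tmp (reg_of x)]"
    by (simp_all add: length_address_code)
  obtain X' where X': "runs p (capacity n) (a, X, input s) (w + 4) (a + (w + 4), X', input s)"
    "represents (capacity n) X' s" "X' tmp = address f (vars s y)"
    using runs_address_code[OF X code(1) address_le_capacity[of "vars s y" n]] assms
    by (auto simp: values_le_def)
  let ?X = "X'(address f (vars s y) := vars s x)"
  have v: "vars s x \<le> capacity n" using representsD(1,3)[OF X] by metis
  have "runs p (capacity n) (a + (w + 4), X', input s) 1 (a + (w + 5), ?X, input s)"
    by (rule runs_instr[OF code(2)]) (use v X'(3) in \<open>simp_all add: representsD[OF X'(2)]\<close>)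
  from runs_trans[OF X'(1) this] represents_set_entry[OF X'(2) v]
  show "\<exists>X'. runs p (capacity n) (a, X, input s) (w + 5)
      (a + length (compile (Put f y x) a), X', input ?s) \<and> represents (capacity n) X' ?s"
    by (auto simp: length_address_code ac_simps)
qed simp

lemma executes_Input:
  assumes "values_le n s"
  shows "executes p n (Input x) s 1 (set_var x (next_input s) s\<lparr>input := tl (input s)\<rparr>)"
proof -
  let ?s = "set_var x (next_input s) s\<lparr>input := tl (input s)\<rparr>"
  have item: "next_input s \<le> capacity n"
    using next_input_le[OF assms] by (intro le_capacity) simp
  have "simulated p (capacity n) a s 1 (a + 1) ?s" if "code_at p a [Read (reg_of x)]" for a
  proof (rule simulatedI[where f = "\<lambda>X. X(reg_of x := next_input s)"])
    fix X assume X: "represents (capacity n) X s"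
    show "runs p (capacity n) (a, X, input s) 1 (a + 1, X(reg_of x := next_input s), input ?s)"
      by (rule runs_instr[OF that]) (use item in \<open>simp_all add: representsD[OF X]\<close>)
    show "represents (capacity n) (X(reg_of x := next_input s)) ?s"
      using represents_set_var[OF X item, of x] by (simp add: represents_def)
  qed
  then show ?thesis by (simp add: executes_def)
qed

lemma executes_Seq:
  assumes "executes p n c s t s'" "executes p n d s' t' s''"
  shows "executes p n (c ;; d) s (t + t') s''"
  unfolding executes_def
proof (intro allI impI)
  fix a assume "code_at p a (compile (c ;; d) a)"
  then have "simulated p (capacity n) a s t (a + length (compile c a)) s'"
    "simulated p (capacity n) (a + length (compile c a)) s' t'
      (a + length (compile (c ;; d) a)) s''"
    using assms by (auto simp: executes_def add.assoc)
  then show "simulated p (capacity n) a s (t + t') (a + length (compile (c ;; d) a)) s''"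
    by (rule simulated_trans)
qed

lemma code_at_IfPos:
  assumes "code_at p a (compile (IfPos x c d) a)"
  defines "d_end \<equiv> a + 1 + length (compile d (a + 1))"
  shows "code_at p a [JumpPos (reg_of x) (d_end + 2)]" "code_at p (a + 1) (compile d (a + 1))"
    "code_at p d_end (goto_code (a + length (compile (IfPos x c d) a)))"
    "code_at p (d_end + 2) (compile c (d_end + 2))"
    "a + length (compile (IfPos x c d) a) = d_end + 2 + length (compile c (d_end + 2))"
  using assms by (simp_all add: Let_def goto_code_def numeral_3_eq_3)

lemma code_at_WhilePos:
  assumes "code_at p a (compile (WhilePos x c) a)"
  shows "code_at p a [JumpPos (reg_of x) (a + 3)]"
    "code_at p (a + 1) (goto_code (a + length (compile (WhilePos x c) a)))"
    "code_at p (a + 3) (compile c (a + 3))"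
    "code_at p (a + 3 + length (compile c (a + 3))) (goto_code a)"
  using assms by (simp_all add: Let_def goto_code_def numeral_3_eq_3)

lemma executes_IfPos:
  assumes "0 < vars s x" "executes p n c s t s'"
  shows "executes p n (IfPos x c d) s (1 + t) s'"
  unfolding executes_def
proof (intro allI impI)
  fix a assume "code_at p a (compile (IfPos x c d) a)"
  note code = code_at_IfPos[OF this]
  show "simulated p (capacity n) a s (1 + t) (a + length (compile (IfPos x c d) a)) s'"
    unfolding code(5)
    using simulated_jump(1)[OF code(1) assms(1)] executesD[OF assms(2) code(4)]
    by (rule simulated_trans)
qed

lemma executes_IfZero:
  assumes "vars s x = 0" "executes p n d s t s'"
  shows "executes p n (IfPos x c d) s (1 + (t + 2)) s'"
  unfolding executes_def
proof (intro allI impI)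
  fix a assume "code_at p a (compile (IfPos x c d) a)"
  note code = code_at_IfPos[OF this]
  have "simulated p (capacity n) a s 1 (a + 1) s" by (rule simulated_jump(2)[OF code(1) assms(1)])
  then show "simulated p (capacity n) a s (1 + (t + 2)) (a + length (compile (IfPos x c d) a)) s'"
    using executesD[OF assms(2) code(2)] simulated_goto[OF code(3)]
    by (blast intro: simulated_trans)
qed

lemma executes_WhilePos:
  assumes "0 < vars s x" "executes p n c s t s'" "executes p n (WhilePos x c) s' t' s''"
  shows "executes p n (WhilePos x c) s (1 + (t + (2 + t'))) s''"
  unfolding executes_def
proof (intro allI impI)
  fix a assume loop: "code_at p a (compile (WhilePos x c) a)"
  note code = code_at_WhilePos[OF loop]
  have "simulated p (capacity n) a s 1 (a + 3) s" by (rule simulated_jump(1)[OF code(1) assms(1)])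
  then show "simulated p (capacity n) a s (1 + (t + (2 + t')))
      (a + length (compile (WhilePos x c) a)) s''"
    using executesD[OF assms(2) code(3)] simulated_goto[OF code(4)] executesD[OF assms(3) loop]
    by (blast intro: simulated_trans)
qed

lemma executes_WhileZero:
  assumes "vars s x = 0"
  shows "executes p n (WhilePos x c) s (1 + 2) s"
  unfolding executes_def
proof (intro allI impI)
  fix a assume "code_at p a (compile (WhilePos x c) a)"
  note code = code_at_WhilePos[OF this]
  have "simulated p (capacity n) a s 1 (a + 1) s" by (rule simulated_jump(2)[OF code(1) assms(1)])
  then show "simulated p (capacity n) a s (1 + 2) (a + length (compile (WhilePos x c) a)) s"
    using simulated_goto[OF code(2)] by (rule simulated_trans)
qed

theorem executes_if_big_step:
  assumes "big_step c s t s'" "values_le m s" "m + t \<le> n"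
  shows "executes p n c s ((w + 5) * t) s'"
  using assms
proof (induction arbitrary: m rule: big_step.induct)
  case (Skip s)
  then show ?case using executes_Skip by simp
next
  case (Assign x e s)
  then have "values_le n s" by (auto intro: values_le_mono)
  from executes_Assign[OF this] show ?case by (rule executes_mono) simp
next
  case (Get x f y s)
  then have "values_le n s" by (auto intro: values_le_mono)
  then show ?case using executes_Get by simp
next
  case (Put f y x s)
  then have "values_le n s" by (auto intro: values_le_mono)
  then show ?case using executes_Put by simp
next
  case (Input x s)
  then have "values_le n s" by (auto intro: values_le_mono)
  from executes_Input[OF this] show ?case by (rule executes_mono) simp
next
  case (Seq c s t s' d t' s'')
  have time: "m + t \<le> n" "m + t + t' \<le> n" using Seq.prems(2) by simp_all
  have "values_le (m + t) s'" using Seq.hyps(1) Seq.prems(1) by (rule big_step_values_le)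
  from executes_Seq[OF Seq.IH(1)[OF Seq.prems(1) time(1)] Seq.IH(2)[OF this time(2)]]
  show ?case by (simp add: distrib_left)
next
  case (IfPos s x c t s' d)
  then show ?case by (intro executes_mono[OF executes_IfPos[where t = "(w + 5) * t"]]) simp_all
next
  case (IfZero s x d t s' c)
  then show ?case by (intro executes_mono[OF executes_IfZero[where t = "(w + 5) * t"]]) simp_all
next
  case (WhilePos s x c t s' t' s'')
  have time: "m + t \<le> n" "m + t + t' \<le> n" using WhilePos.prems(2) by simp_all
  have "values_le (m + t) s'" using WhilePos.hyps(2) WhilePos.prems(1) by (rule big_step_values_le)
  note body_rest = WhilePos.IH(1)[OF WhilePos.prems(1) time(1)] WhilePos.IH(2)[OF this time(2)]
  from executes_WhilePos[OF WhilePos.hyps(1) body_rest] show ?case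
    by (rule executes_mono) (simp add: distrib_left)
next
  case (WhileZero s x c)
  from executes_WhileZero[OF this(1)] show ?case by (rule executes_mono) simp
qed

end

definition initial :: "nat list \<Rightarrow> ('v, 'f) state" where
  "initial xs = \<lparr>vars = \<lambda>_. 0, arrs = \<lambda>_ _. 0, input = xs\<rparr>"

lemma input_initial: "input (initial xs) = xs"
  by (simp add: initial_def)

lemma run_halted:
  assumes "halted p (run p xs u)" "u \<le> t"
  shows "run p xs t = run p xs u"
proof -
  have "(step p ^^ k) c = c" if "halted p c" for k c
    using that by (induction k) (auto simp: step_def)
  moreover have "run p xs t = (step p ^^ (t - u)) (run p xs u)"
    using assms(2) funpow_add[of "t - u" u "step p"] by (simp add: run_def)
  ultimately show ?thesis using assms(1) by simp
qed

context layout
begin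

lemma compile_run:
  assumes "big_step c (initial xs) t s"
  defines "p \<equiv> compile c 0" and "m \<equiv> Max (insert 0 (set xs))"
  obtains u where "u \<le> (w + 5) * t" "halted p (run p xs u)"
    "\<And>x. reg (run p xs u) (reg_of x) = vars s x" "\<And>v i. reg (run p xs v) i \<le> capacity (m + t)"
proof -
  have init: "represents (capacity (m + t)) (\<lambda>_. 0) (initial xs)"
    by (simp add: represents_def initial_def)
  have "values_le m (initial xs)" by (simp add: values_le_def initial_def m_def)
  then have "executes p (m + t) c (initial xs) ((w + 5) * t) s"
    by (rule executes_if_big_step[OF assms(1)]) simp
  then have "simulated p (capacity (m + t)) 0 (initial xs) ((w + 5) * t) (length p) s"
    using executesD[of p _ c _ _ _ 0] by (simp add: p_def code_at_def)
  from this[unfolded simulated_def input_initial, rule_format, OF init] obtain u X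
    where u: "u \<le> (w + 5) * t"
    "runs p (capacity (m + t)) (0, \<lambda>_. 0, xs) u (length p, X, input s)"
    "represents (capacity (m + t)) X s"
    by blast
  then have run_u: "run p xs u = (length p, X, input s)" by (simp add: runs_def run_def)
  then have halt: "halted p (run p xs u)" by (simp add: halted_def)
  have "reg (run p xs v) i \<le> capacity (m + t)" for v i
  proof (cases "v \<le> u")
    case True
    then show ?thesis using u(2) by (simp add: runs_def run_def)
  next
    case False
    then show ?thesis
      using run_halted[OF halt, of v] representsD(3)[OF u(3)] by (simp add: run_u reg_def)
  qed
  then show ?thesis
    using that[OF u(1) halt] representsD(1)[OF u(3)] by (simp add: run_u reg_def)
qed

lemma capacity_le_power:
  assumes "2 \<le> N" "m + 2 \<le> N" "t \<le> N ^ k"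
  shows "capacity (m + t) \<le> N ^ (w + k + 2)"
proof -
  have "m + t + 2 \<le> N + N ^ k" using assms(2,3) by linarith
  also have "\<dots> \<le> N ^ (k + 1) + N ^ (k + 1)"
    using assms(1) power_increasing[of k "k + 1" N] power_increasing[of 1 "k + 1" N]
    by (intro add_mono) auto
  also have "\<dots> = 2 * N ^ (k + 1)" by simp
  also have "\<dots> \<le> N * N ^ (k + 1)" using assms(1) by (rule mult_right_mono) simp
  also have "\<dots> = N ^ (k + 2)" by simp
  finally have "2 ^ w * (m + t + 2) \<le> N ^ w * N ^ (k + 2)"
    using power_mono[OF assms(1), of w] by (intro mult_mono) auto
  then show ?thesis unfolding capacity_def by (simp only: power_add add.assoc)
qed

theorem decidable_in_time_O_if_wp:
  fixes c :: "('v, 'f) com"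
  assumes ans: "reg_of ans = 0" and time: "(\<lambda>n. real (T n)) \<in> O(f)"
    and polynomial: "\<And>x. x \<in> I \<Longrightarrow> T (sz x) \<le> (length (enc x) + 2) ^ k"
    and correct: "\<And>x. x \<in> I \<Longrightarrow>
      wp c (\<lambda>s t. vars s ans = (if Q x then 1 else 0) \<and> t \<le> T (sz x)) (initial (enc x)) 0"
  shows "decidable_in_time_O I enc sz Q f"
  unfolding decidable_in_time_O_def
proof (intro exI conjI ballI)
  show "(\<lambda>n. real ((w + 5) * T n)) \<in> O(f)" using time by simp
  fix x assume x: "x \<in> I"
  let ?p = "compile c 0" and ?m = "Max (insert 0 (set (enc x)))"
  obtain t s where run: "big_step c (initial (enc x)) t s"
    and s: "vars s ans = (if Q x then 1 else 0)" and t: "t \<le> T (sz x)"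
    using correct[OF x] by (auto simp: wp_def)
  obtain u where u: "u \<le> (w + 5) * t" "halted ?p (run ?p (enc x) u)"
    "\<And>x'. reg (run ?p (enc x) u) (reg_of x') = vars s x'"
    "\<And>v i. reg (run ?p (enc x) v) i \<le> capacity (?m + t)"
    using compile_run[OF run] by blast
  have "u \<le> (w + 5) * T (sz x)" using u(1) t by (meson le_trans mult_le_mono2)
  from run_halted[OF u(2) this] show "decides_within ?p (enc x) (Q x) ((w + 5) * T (sz x))"
    using u(2) u(3)[of ans] ans s by (simp add: decides_within_def)
  have "T (sz x) \<le> (length (enc x) + ?m + 2) ^ k"
    using polynomial[OF x] by (rule le_trans) (simp add: power_mono)
  then have "capacity (?m + t) \<le> (length (enc x) + ?m + 2) ^ (w + k + 2)"
    using t by (intro capacity_le_power) simp_all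
  then show "word_bounded ?p (w + k + 2) (enc x)"
    unfolding word_bounded_def using u(4) le_trans by blast
qed

end

section \<open>The program\<close>

datatype var = Ok | Todo | Len | Cnt | Pos | Cur | Go | End | Low | Tmp | Owner | Hd | Tl

text \<open>\<open>Own\<close> maps a position to the interval of the current choice that contains it, and \<open>New\<close> to the
  queued interval that has claimed it. \<open>Flip\<close> marks the intervals of the current choice whose
  letters have changed to another interval.\<close>

datatype arr = Last | Prev | Sibling | Own | New | Flip | Queue

definition load_position :: "(var, arr) com" where
  "load_position =
     Pos ::= Succ Pos ;; Input Cur ;; Get Tmp Last Cur ;; Put Prev Pos Tmp ;; Put Last Cur Pos ;;
     Get Low Prev Tmp ;; IfPos Low (Put Sibling Pos Tmp ;; Put Sibling Tmp Pos) Skip"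

definition load :: "(var, arr) com" where
  "load = Pos ::= Zero ;; Cnt ::= Var Len ;; countdown Cnt load_position"

definition clear :: "(var, arr) com" where
  "clear = Tmp ::= Zero ;; Cnt ::= Var Len ;; countdown Cnt (Put New Cnt Tmp ;; Put Flip Cnt Tmp)"

definition flip :: "(var, arr) com" where
  "flip = Get Tmp Flip Owner ;; IfPos Tmp Skip
     (Tmp ::= Succ Tmp ;; Put Flip Owner Tmp ;; Get Cnt Sibling Owner ;;
      IfPos Cnt (Put Queue Tl Cnt ;; Tl ::= Succ Tl) (Ok ::= Zero))"

definition claim :: "(var, arr) com" where
  "claim = Get Tmp New Pos ;; IfPos Tmp (Ok ::= Zero)
     (Put New Pos End ;; Get Owner Own Pos ;; IfPos Owner flip Skip)"

definition start_interval :: "(var, arr) com" where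
  "start_interval = Get End Queue Hd ;; Get Low Prev End ;; Pos ::= Var End"

definition advance :: "(var, arr) com" where
  "advance = Tmp ::= Minus Pos Low ;; IfPos Tmp (Pos ::= Pred Pos)
     (Hd ::= Succ Hd ;; Tmp ::= Minus Tl Hd ;; IfPos Tmp start_interval (Go ::= Zero))"

definition scan_position :: "(var, arr) com" where
  "scan_position = claim ;; IfPos Ok advance (Go ::= Zero)"

definition search :: "(var, arr) com" where
  "search = Hd ::= Zero ;; Put Queue Hd End ;; Tl ::= Succ Hd ;; Ok ::= Succ Hd ;; Go ::= Succ Hd ;;
     start_interval ;; WhilePos Go scan_position"

definition commit :: "(var, arr) com" where
  "commit = Cnt ::= Var Len ;; countdown Cnt
     (Get Tmp New Cnt ;; IfPos Tmp (Put Own Cnt Tmp)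
        (Get Owner Own Cnt ;; Get Tmp Flip Owner ;;
         IfPos Tmp (Tmp ::= Zero ;; Put Own Cnt Tmp) Skip))"

definition attempt :: "(var, arr) com" where
  "attempt = Get Low Prev End ;;
     IfPos Low (clear ;; search ;; IfPos Ok commit Skip) (Ok ::= Zero)"

definition insert_letter :: "(var, arr) com" where
  "insert_letter = Get End Last Cur ;; attempt ;;
     IfPos Ok Skip (Get End Last Cur ;; Get End Prev End ;; attempt)"

definition insert_letters :: "(var, arr) com" where
  "insert_letters = Tmp ::= Zero ;; Ok ::= Succ Tmp ;;
     countdown Todo (Cur ::= Pred Todo ;; IfPos Ok insert_letter Skip)"

definition FT3 :: "(var, arr) com" where
  "FT3 = Input Todo ;; Input Len ;; Tmp ::= Minus Todo Len ;;
     IfPos Tmp Skip (load ;; insert_letters)"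

lemma assigned_programs [simp]:
  "assigned clear = {Tmp, Cnt}" "assigned claim = {Tmp, Ok, Owner, Cnt, Tl}"
  "assigned start_interval = {End, Low, Pos}"
  "assigned search = {Hd, Tl, Ok, Go, End, Low, Pos, Tmp, Owner, Cnt}"
  "assigned commit = {Cnt, Tmp, Owner}"
  "assigned attempt = {Low, Tmp, Cnt, Hd, Tl, Ok, Go, End, Pos, Owner}"
  "assigned insert_letter = {Low, Tmp, Cnt, Hd, Tl, Ok, Go, End, Pos, Owner}"
  "assigned load = {Pos, Cur, Tmp, Low, Cnt}"
  by (auto simp: clear_def claim_def flip_def start_interval_def advance_def scan_position_def
      search_def commit_def attempt_def insert_letter_def load_def load_position_def countdown_def)

lemma stored_programs [simp]:
  "stored clear = {New, Flip}" "stored claim = {New, Flip, Queue}"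
  "stored start_interval = {}" "stored advance = {}"
  "stored scan_position = {New, Flip, Queue}" "stored search = {New, Flip, Queue}"
  "stored commit = {Own}" "stored attempt = {New, Flip, Queue, Own}"
  "stored insert_letter = {New, Flip, Queue, Own}" "stored load = {Last, Prev, Sibling}"
  by (auto simp: clear_def claim_def flip_def start_interval_def advance_def scan_position_def
      search_def commit_def attempt_def insert_letter_def load_def load_position_def countdown_def)

section \<open>Tables of occurrences\<close>

definition tables :: "nat list \<Rightarrow> nat \<Rightarrow> (var, arr) state \<Rightarrow> bool" where
  "tables S i s \<longleftrightarrow>
     (\<forall>a. arrs s Last a = last_occ S a i) \<and> (\<forall>k\<le>i. arrs s Prev k = prev_occ S k) \<and>
     tabulates (length S) (siblings S \<inter> {..i} \<times> {..i}) (arrs s Sibling)"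

lemma tablesD:
  assumes "tables S i s"
  shows "arrs s Last a = last_occ S a i" "k \<le> i \<Longrightarrow> arrs s Prev k = prev_occ S k"
    "tabulates (length S) (siblings S \<inter> {..i} \<times> {..i}) (arrs s Sibling)"
  using assms by (auto simp: tables_def)

lemma tables_frame:
  assumes "tables S i s" "frame c s s'" "stored c \<inter> {Last, Prev, Sibling} = {}"
  shows "tables S i s'"
  using assms by (auto simp: tables_def frame_def disjoint_iff)

lemma load_position_correct:
  assumes count: "\<And>a. count_list S a \<le> 3" and tables: "tables S i s"
    and pos: "vars s Pos = i" and inp: "input s = drop i S" and i: "i < length S"
  shows "wp load_position (\<lambda>s' t'. tables S (Suc i) s' \<and> vars s' Pos = Suc i \<and>
    input s' = drop (Suc i) S \<and> t' \<le> t + 9) s t"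
proof -
  let ?p = "prev_occ S (Suc i)"
  have read: "next_input s = S ! i" "tl (input s) = drop (Suc i) S"
    using inp i by (simp_all flip: Cons_nth_drop_Suc)
  have last: "arrs s Last (S ! i) = ?p" and "?p \<le> i"
    using tablesD(1)[OF tables] prev_occ_less[of "Suc i" S]
    by (simp_all add: prev_occ_def letter_def)
  then have prev: "arrs s Prev ?p = prev_occ S ?p" using tablesD(2)[OF tables] by simp
  have new_tables: "tables S (Suc i) s'"
    if "arrs s' Last = (arrs s Last)(S ! i := Suc i)" "arrs s' Prev = (arrs s Prev)(Suc i := ?p)"
      "arrs s' Sibling = (if 0 < prev_occ S ?p
        then (arrs s Sibling)(Suc i := ?p, ?p := Suc i) else arrs s Sibling)" for s'
    using tables that tabulates_siblings_Suc[OF count i tablesD(3)[OF tables]]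
    by (auto simp: tables_def le_Suc_eq)
  show ?thesis
    unfolding load_position_def
    by (cases "0 < prev_occ S ?p")
      (use \<open>?p \<le> i\<close> in \<open>auto simp: wp_simps pos read last prev intro!: new_tables\<close>)
qed

lemma load_correct:
  assumes count: "\<And>a. count_list S a \<le> 3" and tables: "tables S 0 s"
    and len: "vars s Len = length S" and inp: "input s = S"
  shows "wp load (\<lambda>s' t'. tables S (length S) s' \<and> t' \<le> t + 11 * length S + 3) s t"
proof -
  let ?n = "length S"
  define I where "I k s' \<longleftrightarrow> tables S (?n - k) s' \<and> vars s' Pos = ?n - k \<and> input s' = drop (?n - k) S"
    for k and s' :: "(var, arr) state"
  let ?s = "set_var Cnt ?n (set_var Pos 0 s)"
  have "wp (countdown Cnt load_position)
      (\<lambda>s' t'. I 0 s' \<and> t' \<le> (t + 2) + (9 + 2) * ?n + 1) ?s (t + 2)"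
  proof (rule wp_countdown)
    show "I ?n ?s" using tables inp by (simp add: I_def tables_def)
  next
    fix k s' t'
    assume k: "k < ?n" and "I (Suc k) s'"
    then have "wp load_position (\<lambda>s'' t''. tables S (Suc (?n - Suc k)) s'' \<and>
        vars s'' Pos = Suc (?n - Suc k) \<and> input s'' = drop (Suc (?n - Suc k)) S \<and>
        t'' \<le> t' + 9) s' t'"
      by (intro load_position_correct count) (simp_all add: I_def)
    then show "wp load_position (\<lambda>s'' t''. I k (set_var Cnt k s'') \<and> t'' \<le> t' + 9) s' t'"
      using k by (auto simp: I_def tables_def Suc_diff_Suc elim!: wp_conseq)
  qed (simp_all add: load_position_def)
  then show ?thesis
    using len by (auto simp: load_def wp_simps I_def elim!: wp_conseq)
qed

section \<open>Correctness of an attempt\<close>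

lemma clear_correct:
  assumes "vars s Len = n"
  shows "wp clear (\<lambda>s' t'. (\<forall>k\<in>{1..n}. arrs s' New k = 0 \<and> arrs s' Flip k = 0) \<and>
    t' \<le> t + 4 * n + 3) s t"
proof -
  define I where "I k s' \<longleftrightarrow> vars s' Tmp = 0 \<and> (\<forall>j\<in>{k<..n}. arrs s' New j = 0 \<and> arrs s' Flip j = 0)"
    for k and s' :: "(var, arr) state"
  let ?s = "set_var Cnt n (set_var Tmp 0 s)"
  have "wp (countdown Cnt (Put New Cnt Tmp ;; Put Flip Cnt Tmp))
      (\<lambda>s' t'. I 0 s' \<and> t' \<le> (t + 2) + (2 + 2) * n + 1) ?s (t + 2)"
  proof (rule wp_countdown)
    fix k s' t'
    assume "I (Suc k) s'" "vars s' Cnt = Suc k"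
    then show "wp (Put New Cnt Tmp ;; Put Flip Cnt Tmp)
        (\<lambda>s'' t''. I k (set_var Cnt k s'') \<and> t'' \<le> t' + 2) s' t'"
      by (auto simp: wp_simps I_def)
  qed (simp_all add: I_def)
  then show ?thesis
    using assms by (auto simp: clear_def wp_simps I_def elim!: wp_conseq)
qed

lemma commit_correct:
  assumes "vars s Len = n"
  shows "wp commit (\<lambda>s' t'.
    (\<forall>k\<in>{1..n}. arrs s' Own k = reassigned (arrs s Own) (arrs s New) (arrs s Flip) k) \<and>
    t' \<le> t + 9 * n + 2) s t"
proof -
  let ?own = "reassigned (arrs s Own) (arrs s New) (arrs s Flip)"
  define I where "I k s' \<longleftrightarrow> (\<forall>j. arrs s' Own j = (if j \<in> {k<..n} then ?own j else arrs s Own j))"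
    for k and s' :: "(var, arr) state"
  let ?body = "Get Tmp New Cnt ;; IfPos Tmp (Put Own Cnt Tmp)
    (Get Owner Own Cnt ;; Get Tmp Flip Owner ;; IfPos Tmp (Tmp ::= Zero ;; Put Own Cnt Tmp) Skip)"
  let ?s = "set_var Cnt n s"
  have "wp (countdown Cnt ?body)
      (\<lambda>s' t'. I 0 s' \<and> t' \<le> (t + 1) + (7 + 2) * n + 1) ?s (t + 1)"
  proof (rule wp_countdown)
    fix k s' t'
    assume "k < n" "frame (countdown Cnt ?body) ?s s'" "I (Suc k) s'" "vars s' Cnt = Suc k"
    moreover from this have "arrs s' New = arrs s New" "arrs s' Flip = arrs s Flip"
      by (simp_all add: frame_def countdown_def)
    moreover have "{k<..n} = insert (Suc k) {Suc k<..n}" using calculation(1) by auto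
    ultimately show "wp ?body (\<lambda>s'' t''. I k (set_var Cnt k s'') \<and> t'' \<le> t' + 7) s' t'"
      by (auto simp: wp_simps I_def reassigned_def)
  qed (simp_all add: I_def)
  then show ?thesis
    using assms by (auto simp: commit_def wp_simps I_def elim!: wp_conseq)
qed

definition queue :: "(var, arr) state \<Rightarrow> nat list" where
  "queue s = map (arrs s Queue) [0..<vars s Tl]"

lemma length_queue: "length (queue s) = vars s Tl"
  by (simp add: queue_def)

lemma queue_nth: "h < vars s Tl \<Longrightarrow> queue s ! h = arrs s Queue h"
  by (simp add: queue_def)

lemma queue_vars_update [simp]: "V Tl = vars s Tl \<Longrightarrow> queue (s\<lparr>vars := V\<rparr>) = queue s"
  by (simp add: queue_def)

locale FT3_insertion = insertion S B C e0
  for S :: "nat list" and B C e0 +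
  fixes own :: "nat \<Rightarrow> nat"
  assumes count: "count_list S a \<le> 3" and own: "tabulates (length S) (cover S C) own"
begin

lemma owner_unique:
  assumes "k \<in> {1..length S}" "(k, r) \<in> cover S C"
  shows "own k = r"
  using assms pair_endsD(3) C_selection(1) tabulatesD[OF own assms(1), of r]
  by (auto simp: cover_def)

lemma owner_cases:
  assumes "k \<in> {1..length S}"
  obtains
    (unowned) "own k = 0" "\<And>r. (k, r) \<notin> cover S C"
  | (owned) "0 < own k" "(k, own k) \<in> cover S C" "\<And>r. (k, r) \<in> cover S C \<Longrightarrow> r = own k"
proof (cases "own k = 0")
  case True
  then have "(k, r) \<notin> cover S C" for r
    using owner_unique[OF assms, of r] C_selection(1) pair_endsD(3) by (fastforce simp: cover_def)
  with True show ?thesis using unowned by blast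
next
  case False
  then have "(k, own k) \<in> cover S C" using tabulatesD[OF own assms, of "own k"] by simp
  with False show ?thesis using owned owner_unique[OF assms] by blast
qed

lemma sibling_entry:
  assumes "tables S (length S) s" "r \<in> C"
  shows "arrs s Sibling r = 0 \<Longrightarrow> r \<notin> Domain (siblings S)"
    "0 < arrs s Sibling r \<Longrightarrow> (r, arrs s Sibling r) \<in> siblings S"
proof -
  have "r \<in> {1..length S}" using assms(2) C_selection(1) pair_ends_subset by blast
  note entry = tabulatesD[OF tablesD(3)[OF assms(1)] this]
  show "0 < arrs s Sibling r \<Longrightarrow> (r, arrs s Sibling r) \<in> siblings S" using entry by blast
  show "r \<notin> Domain (siblings S)" if "arrs s Sibling r = 0"
  proof
    assume "r \<in> Domain (siblings S)"
    then obtain y where y: "(r, y) \<in> siblings S" by blast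
    then have "r \<in> {1..length S}" "y \<in> {1..length S}"
      using pair_ends_subset[of S] unfolding siblings_def by blast+
    then show False using entry[of y] y that by auto
  qed
qed

definition claimed :: "(nat \<times> nat) set \<Rightarrow> (var, arr) state \<Rightarrow> bool" where
  "claimed R s \<longleftrightarrow> displacement (set (queue s)) \<and> distinct (queue s) \<and>
     vacated (set (queue s)) R \<and> tabulates (length S) R (arrs s New) \<and>
     (\<forall>r\<in>C. 0 < arrs s Flip r \<longleftrightarrow> r \<in> displaced (set (queue s)))"

lemma claimed_vars_update [simp]:
  "V Tl = vars s Tl \<Longrightarrow> claimed R (s\<lparr>vars := V\<rparr>) \<longleftrightarrow> claimed R s"
  by (simp add: claimed_def)

lemma claimedD:
  assumes "claimed R s"
  shows "displacement (set (queue s))" "distinct (queue s)" "vacated (set (queue s)) R"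
    "tabulates (length S) R (arrs s New)"
    "r \<in> C \<Longrightarrow> 0 < arrs s Flip r \<longleftrightarrow> r \<in> displaced (set (queue s))"
  using assms by (auto simp: claimed_def)

lemma queue_subset_pair_ends: "claimed R s \<Longrightarrow> set (queue s) \<subseteq> pair_ends S"
  by (rule displacementD(2)[OF claimedD(1)])

lemma excluded_if_claimed_twice:
  assumes claimed: "claimed R s" "R \<subseteq> cover S (set (queue s))"
    and k: "k \<in> {1..length S}" "(k, e) \<in> cover S (set (queue s)) - R" "0 < arrs s New k"
  shows "excluded S B e0"
proof -
  have "(k, arrs s New k) \<in> R" using tabulatesD[OF claimedD(4)[OF claimed(1)] k(1,3)] by simp
  then show ?thesis
    using excluded_if_overlap[OF claimedD(1)[OF claimed(1)], of k e "arrs s New k"]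
      claimed(2) k(2) by blast
qed

lemma claimed_insert:
  assumes claimed: "claimed R s" and new: "arrs s New k = 0" "0 < e"
    and vacant: "\<And>r. (k, r) \<in> cover S C \<Longrightarrow> r \<in> displaced (set (queue s))"
    and s': "arrs s' = (arrs s)(New := (arrs s New)(k := e))" "vars s' Tl = vars s Tl"
  shows "claimed (insert (k, e) R) s'"
proof -
  have "queue s' = queue s" using s' by (simp add: queue_def)
  then show ?thesis
    using claimedD[OF claimed] vacated_insert[OF claimedD(3)[OF claimed] vacant, of k e]
      tabulates_insert[OF claimedD(4)[OF claimed] new] s'(1)
    by (simp add: claimed_def)
qed

lemma claimed_insert_flip:
  assumes claimed: "claimed R s"
    and k: "k \<in> {1..length S}" "arrs s New k = 0" "(k, e) \<in> cover S (set (queue s))" "0 < e"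
    and r: "(k, r) \<in> cover S C" "arrs s Flip r = 0" and y: "(r, y) \<in> siblings S"
    and s': "arrs s' = (arrs s)(New := (arrs s New)(k := e), Flip := (arrs s Flip)(r := 1),
        Queue := (arrs s Queue)(vars s Tl := y))" "vars s' Tl = Suc (vars s Tl)"
  shows "claimed (insert (k, e) R) s'"
proof -
  let ?D = "set (queue s)"
  note claimed = claimedD[OF claimed]
  have queue: "queue s' = queue s @ [y]" using s' by (simp add: queue_def)
  have rC: "r \<in> C" and letters: "letter S y = letter S r"
    using r(1) y by (auto simp: cover_def siblings_def)
  then have fresh: "r \<notin> displaced ?D" using claimed(5)[OF rC] r(2) by simp
  then have "letter S y \<notin> letter S ` ?D" using rC letters by (simp add: displaced_def)
  then have "y \<notin> ?D" by blast
  have moved: "displaced (insert y ?D) = insert r (displaced ?D)"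
    using rC letters by (rule displaced_insert)
  have "displacement (insert y ?D)"
    using displacement_insert[OF claimed(1) k(3) r(1) fresh y siblings_single_valued[OF count]] .
  moreover have "r' = r" if "(k, r') \<in> cover S C" for r'
    using owner_unique[OF k(1)] r(1) that by metis
  then have "vacated (insert y ?D) (insert (k, e) R)"
    by (intro vacated_insert vacated_mono[OF claimed(3)]) (auto simp: moved)
  ultimately show ?thesis
    using claimed(2,5) \<open>y \<notin> ?D\<close> tabulates_insert[OF claimed(4) k(2,4)] s'(1)
    by (simp add: claimed_def queue moved)
qed

definition claim_result :: "(nat \<times> nat) set \<Rightarrow> (var, arr) state \<Rightarrow> (var, arr) state \<Rightarrow> bool" where
  "claim_result R s s' \<longleftrightarrow>
     (if vars s' Ok = 0 then excluded S B e0
      else vars s' Ok = 1 \<and> claimed (insert (vars s Pos, vars s End) R) s' \<and>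
        vars s Tl \<le> vars s' Tl \<and> take (vars s Tl) (queue s') = queue s \<and>
        arrs s New (vars s Pos) = 0 \<and> arrs s' New = (arrs s New)(vars s Pos := vars s End))"

lemma claim_owned_correct:
  assumes tables: "tables S (length S) s" and s_own: "arrs s Own = own"
    and claimed: "claimed R s" and ok: "vars s Ok = 1"
    and k: "vars s Pos \<in> {1..length S}" "arrs s New (vars s Pos) = 0"
      "(vars s Pos, vars s End) \<in> cover S (set (queue s))" "0 < vars s End"
    and owned: "0 < own (vars s Pos)" "(vars s Pos, own (vars s Pos)) \<in> cover S C"
      "\<And>r. (vars s Pos, r) \<in> cover S C \<Longrightarrow> r = own (vars s Pos)"
  shows "wp claim (\<lambda>s' t'. t' \<le> t + 13 \<and> claim_result R s s') s t"
proof -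
  let ?r = "own (vars s Pos)" and ?D = "set (queue s)"
  let ?y = "arrs s Sibling ?r"
  have rC: "?r \<in> C" using owned(2) by (simp add: cover_def)
  consider (flipped) "0 < arrs s Flip ?r" | (stuck) "arrs s Flip ?r = 0" "?y = 0"
    | (flip) "arrs s Flip ?r = 0" "0 < ?y"
    by blast
  then show ?thesis
  proof cases
    case flipped
    then have "r \<in> displaced ?D" if "(vars s Pos, r) \<in> cover S C" for r
      using claimedD(5)[OF claimed rC] owned(3)[OF that] by simp
    note claimed' = claimed_insert[OF claimed k(2,4) this]
    show ?thesis
      using owned(1) k(2) ok flipped
      by (simp add: claim_def flip_def wp_simps s_own claim_result_def)
        (simp add: queue_def claimed')
  next
    case stuck
    have "excluded S B e0"
      using excluded_if_no_sibling[OF claimedD(1)[OF claimed] k(3) owned(2)]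
        sibling_entry(1)[OF tables rC stuck(2)] .
    then show ?thesis
      using owned(1) k(2) ok stuck by (simp add: claim_def flip_def wp_simps s_own claim_result_def)
  next
    case flip
    note claimed' =
      claimed_insert_flip[OF claimed k owned(2) flip(1) sibling_entry(2)[OF tables rC flip(2)]]
    show ?thesis
      using owned(1) k(2) ok flip
      by (auto simp: claim_def flip_def wp_simps s_own claim_result_def queue_def intro!: claimed')
  qed
qed

lemma claim_correct:
  assumes tables: "tables S (length S) s" and s_own: "arrs s Own = own"
    and claimed: "claimed R s" "R \<subseteq> cover S (set (queue s))" and ok: "vars s Ok = 1"
    and unclaimed: "(vars s Pos, vars s End) \<in> cover S (set (queue s)) - R"
  shows "wp claim (\<lambda>s' t'. t' \<le> t + 13 \<and> claim_result R s s') s t"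
proof -
  let ?k = "vars s Pos" and ?e = "vars s End"
  have "?e \<in> pair_ends S" "?k \<in> interval S ?e"
    using unclaimed queue_subset_pair_ends[OF claimed(1)] by (auto simp: cover_def)
  then have k: "?k \<in> {1..length S}" and e: "0 < ?e"
    using interval_subset pair_endsD(3) by blast+
  show ?thesis
  proof (cases "arrs s New ?k = 0")
    case False
    then have "excluded S B e0" using excluded_if_claimed_twice[OF claimed k unclaimed] by simp
    then show ?thesis using False by (simp add: claim_def wp_simps claim_result_def)
  next
    case new: True
    show ?thesis
      using k
    proof (cases rule: owner_cases)
      case unowned
      then show ?thesis
        using new ok
        by (auto simp: claim_def wp_simps s_own claim_result_def queue_def
            intro!: claimed_insert[OF claimed(1) new e])
    next
      case owned
      have "(?k, ?e) \<in> cover S (set (queue s))" using unclaimed by simp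
      from claim_owned_correct[OF tables s_own claimed(1) ok k new this e owned] show ?thesis .
    qed
  qed
qed

definition scanning :: "(var, arr) state \<Rightarrow> bool" where
  "scanning s \<longleftrightarrow> vars s Ok = 1 \<and> vars s Hd < vars s Tl \<and> vars s End = queue s ! vars s Hd \<and>
     vars s Low = prev_occ S (vars s End) \<and> vars s Pos \<in> interval S (vars s End) \<and>
     claimed (claims S (queue s) (vars s Hd) (Suc (vars s Pos))) s"

definition search_result :: "(var, arr) state \<Rightarrow> bool" where
  "search_result s \<longleftrightarrow> (if vars s Ok = 0 then excluded S B e0
     else vars s Ok = 1 \<and> claimed (cover S (set (queue s))) s)"

definition unclaimed :: "(var, arr) state \<Rightarrow> nat" where
  "unclaimed s = card {k \<in> {1..length S}. arrs s New k = 0}"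

lemma scanningD:
  assumes "scanning s"
  shows "vars s Ok = 1" "vars s Hd < vars s Tl" "vars s End = queue s ! vars s Hd"
    "vars s Low = prev_occ S (vars s End)" "vars s Pos \<in> interval S (vars s End)"
    "claimed (claims S (queue s) (vars s Hd) (Suc (vars s Pos))) s" "vars s End \<in> set (queue s)"
  using assms by (auto simp: scanning_def length_queue)

lemma scanning_unclaimed:
  assumes "scanning s"
  shows "(vars s Pos, vars s End) \<in>
    cover S (set (queue s)) - claims S (queue s) (vars s Hd) (Suc (vars s Pos))"
  using current_notin_claims[OF claimedD(2)[OF scanningD(6)[OF assms]], of "vars s Hd"]
    scanningD[OF assms] by (auto simp: cover_def length_queue)

lemma start_interval_correct:
  assumes tables: "tables S (length S) s" and ok: "vars s Ok = 1"
    and hd: "vars s Hd < vars s Tl"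
    and claimed: "claimed (cover S (set (take (vars s Hd) (queue s)))) s"
  shows "wp start_interval (\<lambda>s' t'. t' = t + 3 \<and> scanning s') s t"
proof -
  let ?e = "queue s ! vars s Hd"
  have "?e \<in> set (queue s)" using hd by (simp add: length_queue)
  then have "?e \<in> pair_ends S" using queue_subset_pair_ends[OF claimed] by blast
  then have "?e \<in> interval S ?e" "arrs s Prev ?e = prev_occ S ?e"
    using pair_end_in_interval pair_endsD(4) tablesD(2)[OF tables] by blast+
  then show ?thesis
    using ok hd claimed
    by (simp add: start_interval_def wp_simps scanning_def claims_start flip: queue_nth[OF hd])
qed

lemma advance_correct:
  assumes tables: "tables S (length S) s" and ok: "vars s Ok = 1" "0 < vars s Go"
    and hd: "vars s Hd < vars s Tl"
    and current: "vars s End = queue s ! vars s Hd" "vars s Low = prev_occ S (vars s End)"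
      "vars s Pos \<in> interval S (vars s End)"
    and claimed: "claimed (claims S (queue s) (vars s Hd) (vars s Pos)) s"
  shows "wp advance (\<lambda>s' t'. t' \<le> t + 8 \<and>
    (if 0 < vars s' Go then scanning s' else search_result s')) s t"
proof (cases "vars s Low < vars s Pos")
  case True
  then have "vars s Pos - 1 \<in> interval S (vars s End)" using current by (auto simp: interval_def)
  then show ?thesis
    using True ok hd current claimed by (simp add: advance_def wp_simps scanning_def)
next
  case at_low: False
  then have "vars s Pos = prev_occ S (queue s ! vars s Hd)"
    using current by (simp add: interval_def)
  then have finished: "claimed (cover S (set (take (Suc (vars s Hd)) (queue s)))) s"
    using claimed hd by (simp add: claims_finish length_queue)
  show ?thesis
  proof (cases "Suc (vars s Hd) < vars s Tl")
    case True
    let ?s = "set_var Tmp (vars s Tl - Suc (vars s Hd)) (set_var Hd (Suc (vars s Hd)) s)"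
    have "wp start_interval (\<lambda>s' t'. t' = t + 5 + 3 \<and> scanning s') ?s (t + 5)"
      by (rule start_interval_correct)
        (use True tables ok finished in \<open>simp_all add: tables_def\<close>)
    then show ?thesis
      using at_low True ok(2)
      by (auto simp: advance_def wp_simps eval_nat_numeral frame_def elim!: wp_conseq)
  next
    case last: False
    then have "take (Suc (vars s Hd)) (queue s) = queue s" by (simp add: length_queue)
    then show ?thesis
      using at_low last ok finished by (simp add: advance_def wp_simps search_result_def)
  qed
qed

lemma scanning_claim_result:
  assumes scanning: "scanning s" and frame: "frame claim s s'" and ok: "vars s' Ok \<noteq> 0"
    and result: "claim_result (claims S (queue s) (vars s Hd) (Suc (vars s Pos))) s s'"
  shows "vars s' Ok = 1" "vars s' Hd < vars s' Tl" "vars s' End = queue s' ! vars s' Hd"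
    "claimed (claims S (queue s') (vars s' Hd) (vars s' Pos)) s'" "unclaimed s' < unclaimed s"
proof -
  let ?R = "claims S (queue s) (vars s Hd) (Suc (vars s Pos))"
  note scan = scanningD[OF scanning]
  have same: "vars s' Hd = vars s Hd" "vars s' Pos = vars s Pos" "vars s' End = vars s End"
    using frame by (simp_all add: frame_def)
  have claimed: "claimed (insert (vars s Pos, vars s End) ?R) s'"
    and queue: "take (vars s Tl) (queue s') = queue s" "vars s Tl \<le> vars s' Tl"
    and new: "arrs s New (vars s Pos) = 0" "arrs s' New = (arrs s New)(vars s Pos := vars s End)"
    and ok': "vars s' Ok = 1"
    using result ok by (auto simp: claim_result_def)
  show "vars s' Ok = 1" by (fact ok')
  show "vars s' Hd < vars s' Tl" using scan(2) queue(2) same by simp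
  obtain ds where ds: "queue s' = queue s @ ds" using queue(1) append_take_drop_id by metis
  show "vars s' End = queue s' ! vars s' Hd"
    using scan(2,3) same by (simp add: ds nth_append length_queue)
  show "claimed (claims S (queue s') (vars s' Hd) (vars s' Pos)) s'"
    using claimed claims_insert[of "vars s Pos" S "queue s" "vars s Hd"] scan(2,3,5) same
    by (simp add: ds claims_append length_queue)
  have "vars s End \<in> pair_ends S" using scan(7) queue_subset_pair_ends[OF scan(6)] by blast
  then have "vars s Pos \<in> {1..length S}" "0 < vars s End"
    using scan(5) interval_subset pair_endsD(3) by blast+
  then have "{k \<in> {1..length S}. arrs s' New k = 0} \<subset> {k \<in> {1..length S}. arrs s New k = 0}"
    using new by auto
  then show "unclaimed s' < unclaimed s" unfolding unclaimed_def by (intro psubset_card_mono) auto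
qed

lemma scan_position_correct:
  assumes tables: "tables S (length S) s" and s_own: "arrs s Own = own"
    and scanning: "scanning s" and go: "0 < vars s Go"
  shows "wp scan_position (\<lambda>s' t'. t' \<le> t + 22 \<and>
    (if 0 < vars s' Go then scanning s' \<and> unclaimed s' < unclaimed s else search_result s')) s t"
    (is "wp _ ?Q s t")
proof -
  let ?R = "claims S (queue s) (vars s Hd) (Suc (vars s Pos))"
  note scan = scanningD[OF scanning]
  have "?R \<subseteq> cover S (set (queue s))"
    using scan(2) by (intro claims_subset_cover) (simp add: length_queue)
  from claim_correct[OF tables s_own scan(6) this scan(1) scanning_unclaimed[OF scanning]]
  show ?thesis
    unfolding scan_position_def wp_Seq
  proof (rule wp_conseq, elim conjE)
    fix s1 t1
    assume frame: "frame claim s s1" and t1: "t1 \<le> t + 13" and result: "claim_result ?R s s1"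
    show "wp (IfPos Ok advance (Go ::= Zero)) ?Q s1 t1"
    proof (cases "vars s1 Ok = 0")
      case True
      then show ?thesis
        using t1 result by (simp add: wp_simps claim_result_def search_result_def)
    next
      case False
      note progress = scanning_claim_result[OF scanning frame False result]
      have "wp advance (\<lambda>s' t'. t' \<le> t1 + 1 + 8 \<and>
          (if 0 < vars s' Go then scanning s' else search_result s')) s1 (t1 + 1)"
        using tables_frame[OF tables frame] frame go scan(4,5) progress
        by (intro advance_correct) (simp_all add: frame_def)
      then have "wp advance ?Q s1 (t1 + 1)"
        by (rule wp_conseq)
          (use t1 progress(5) in \<open>auto simp: frame_def unclaimed_def split: if_splits\<close>)
      then show ?thesis using False by (simp add: wp_simps)
    qed
  qed
qed

lemma scan_loop_correct:
  assumes tables: "tables S (length S) s" and s_own: "arrs s Own = own"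
    and scanning: "scanning s" and go: "0 < vars s Go"
  shows "wp (WhilePos Go scan_position)
    (\<lambda>s' t'. search_result s' \<and> t' \<le> t + 23 * length S + 24) s t"
proof -
  define I where "I m s' t' \<longleftrightarrow> (if 0 < vars s' Go then scanning s' \<and> m = Suc (unclaimed s')
      else search_result s' \<and> m = 0) \<and> t' + 23 * m \<le> t + 23 * length S + 23"
    for m s' t'
  have "unclaimed s \<le> card {1..length S}" unfolding unclaimed_def by (intro card_mono) auto
  then have "I (Suc (unclaimed s)) s t" using scanning go by (simp add: I_def)
  then show ?thesis
  proof (rule wp_WhilePos)
    fix m s' t'
    assume frame: "frame scan_position s s'" and I: "I m s' t'" and go: "0 < vars s' Go"
    then have "tables S (length S) s'" "arrs s' Own = own"
      using tables_frame[OF tables frame] s_own by (simp_all add: frame_def)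
    then have "wp scan_position (\<lambda>s'' t''. t'' \<le> t' + 22 \<and> (if 0 < vars s'' Go
        then scanning s'' \<and> unclaimed s'' < unclaimed s' else search_result s'')) s' t'"
      using I go by (intro scan_position_correct) (simp_all add: I_def)
    then show "wp scan_position (\<lambda>s'' t''. \<exists>l<m. I l s'' (Suc t'')) s' t'"
      by (rule wp_conseq) (use I go in \<open>auto simp: I_def split: if_splits\<close>)
  next
    fix m s' t'
    assume "I m s' t'" "vars s' Go = 0"
    then show "search_result s' \<and> Suc t' \<le> t + 23 * length S + 24" by (simp add: I_def)
  qed
qed

lemma search_correct:
  assumes tables: "tables S (length S) s" and s_own: "arrs s Own = own"
    and start: "vars s End = e0"
    and clear: "\<And>k. k \<in> {1..length S} \<Longrightarrow> arrs s New k = 0"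
      "\<And>k. k \<in> {1..length S} \<Longrightarrow> arrs s Flip k = 0"
  shows "wp search (\<lambda>s' t'. search_result s' \<and> t' \<le> t + 23 * length S + 32) s t"
    (is "wp _ ?Q s t")
proof -
  let ?s = "s\<lparr>arrs := (arrs s)(Queue := (arrs s Queue)(0 := e0)),
    vars := (vars s)(Hd := 0, Tl := Suc 0, Ok := Suc 0, Go := Suc 0)\<rparr>"
  have queue: "queue ?s = [e0]" by (simp add: queue_def)
  have "arrs s Flip r = 0" if "r \<in> C" for r
    by (rule clear(2)) (use that C_selection(1) pair_ends_subset in blast)
  then have "claimed {} ?s"
    using displacement_singleton displaced_singleton clear(1)
    by (simp add: claimed_def queue vacated_def tabulates_def)
  then have "wp start_interval (\<lambda>s' t'. t' = t + 5 + 3 \<and> scanning s') ?s (t + 5)"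
    using tables by (intro start_interval_correct) (simp_all add: tables_def queue cover_def)
  then have "wp start_interval (wp (WhilePos Go scan_position) ?Q) ?s (t + 5)"
  proof (rule wp_conseq, elim conjE)
    fix s1 t1
    assume frame: "frame start_interval ?s s1" and t1: "t1 = t + 5 + 3" and scanning: "scanning s1"
    have "tables S (length S) s1" "arrs s1 Own = own" "0 < vars s1 Go"
      using tables s_own frame by (simp_all add: tables_def frame_def)
    from scan_loop_correct[OF this(1,2) scanning this(3)]
    show "wp (WhilePos Go scan_position) ?Q s1 t1" by (rule wp_conseq) (use t1 in auto)
  qed
  then show ?thesis using start by (simp add: search_def wp_simps eval_nat_numeral)
qed

lemma selection_if_committed:
  assumes result: "search_result s" "vars s Ok \<noteq> 0" and s_own: "arrs s Own = own"
    and own': "\<And>k. k \<in> {1..length S} \<Longrightarrow> own' k = reassigned own (arrs s New) (arrs s Flip) k"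
  shows "\<exists>C'. selection S (insert (letter S e0) B) C' \<and> tabulates (length S) (cover S C') own'"
proof -
  let ?D = "set (queue s)"
  have "claimed (cover S ?D) s" using result by (simp add: search_result_def)
  note claimed = claimedD[OF this]
  have "disjoint_family_on (interval S) ?D"
    using displacementD(2)[OF claimed(1)] claimed(4) by (rule disjoint_if_tabulates_cover)
  then have selection': "selection S (insert (letter S e0) B) (C - displaced ?D \<union> ?D)"
    by (rule selection_displacement[OF claimed(1,3)])
  from tabulates_cover_reassigned[OF own claimed(4,5) selectionD(4)[OF this] own']
  have "tabulates (length S) (cover S (C - displaced ?D \<union> ?D)) own'" by blast
  with selection' show ?thesis by blast
qed

end

definition selected :: "nat list \<Rightarrow> nat set \<Rightarrow> (var, arr) state \<Rightarrow> bool" where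
  "selected S B s \<longleftrightarrow>
     (\<exists>C. selection S B C \<and> tabulates (length S) (cover S C) (arrs s Own))"

lemma selected_vars_update [simp]: "selected S B (s\<lparr>vars := V\<rparr>) \<longleftrightarrow> selected S B s"
  by (simp add: selected_def)

definition attempt_result :: "nat list \<Rightarrow> nat set \<Rightarrow> nat \<Rightarrow> nat \<Rightarrow> (var, arr) state \<Rightarrow> bool" where
  "attempt_result S B a e s \<longleftrightarrow>
     (if vars s Ok = 0 then selected S B s \<and> excluded S B e
      else vars s Ok = 1 \<and> selected S (insert a B) s)"

context FT3_insertion
begin

lemma commit_search_result_correct:
  assumes result: "search_result s" "vars s Ok \<noteq> 0" and s_own: "arrs s Own = own"
    and len: "vars s Len = length S"
  shows "wp commit
    (\<lambda>s' t'. attempt_result S B (letter S e0) e0 s' \<and> t' \<le> t + 9 * length S + 2) s t"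
proof (rule wp_conseq[OF commit_correct[OF len]], elim conjE)
  fix s' t'
  assume frame: "frame commit s s'" and t': "t' \<le> t + 9 * length S + 2"
    and own': "\<forall>k\<in>{1..length S}.
      arrs s' Own k = reassigned (arrs s Own) (arrs s New) (arrs s Flip) k"
  have "vars s' Ok = 1" using result frame by (simp add: search_result_def frame_def)
  then show "attempt_result S B (letter S e0) e0 s' \<and> t' \<le> t + 9 * length S + 2"
    using selection_if_committed[OF result s_own, of "arrs s' Own"] s_own own' t'
    by (simp add: attempt_result_def selected_def)
qed

lemma search_commit_correct:
  assumes tables: "tables S (length S) s" and s_own: "arrs s Own = own"
    and start: "vars s End = e0" and len: "vars s Len = length S"
    and clear: "\<And>k. k \<in> {1..length S} \<Longrightarrow> arrs s New k = 0"
      "\<And>k. k \<in> {1..length S} \<Longrightarrow> arrs s Flip k = 0"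
  shows "wp (search ;; IfPos Ok commit Skip)
    (\<lambda>s' t'. attempt_result S B (letter S e0) e0 s' \<and> t' \<le> t + 32 * length S + 35) s t"
    (is "wp _ ?Q s t")
proof -
  have "wp search (\<lambda>s' t'. search_result s' \<and> t' \<le> t + 23 * length S + 32) s t"
    using tables s_own start clear by (rule search_correct)
  then have "wp search (wp (IfPos Ok commit Skip) ?Q) s t"
  proof (rule wp_conseq, elim conjE)
    fix s1 t1
    assume frame: "frame search s s1" and result: "search_result s1"
      and t1: "t1 \<le> t + 23 * length S + 32"
    have own1: "arrs s1 Own = own" and len1: "vars s1 Len = length S"
      using frame s_own len by (simp_all add: frame_def)
    show "wp (IfPos Ok commit Skip) ?Q s1 t1"
    proof (cases "vars s1 Ok = 0")
      case True
      then show ?thesis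
        using result t1 own1 selection own
        by (auto simp: wp_simps attempt_result_def selected_def search_result_def)
    next
      case False
      from commit_search_result_correct[OF result False own1 len1, of "t1 + 1"]
      have "wp commit ?Q s1 (t1 + 1)" by (rule wp_conseq) (use t1 in auto)
      then show ?thesis using False by (simp add: wp_simps)
    qed
  qed
  then show ?thesis by (simp add: wp_Seq)
qed

end

lemma attempt_correct:
  assumes count: "\<And>a. count_list S a \<le> 3" and tables: "tables S (length S) s"
    and len: "vars s Len = length S" and selected: "selected S B s"
    and e: "vars s End = e" "e \<le> length S" "e \<in> pair_ends S \<Longrightarrow> letter S e = a" and a: "a \<notin> B"
  shows "wp attempt (\<lambda>s' t'. attempt_result S B a e s' \<and> t' \<le> t + 36 * length S + 40) s t"
    (is "wp _ ?Q s t")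
proof (cases "e \<in> pair_ends S")
  case False
  then have "arrs s Prev e = 0" using e(2) tablesD(2)[OF tables e(2)] by (simp add: pair_ends_def)
  moreover have "excluded S B e" using False selectionD(1) by (fastforce simp: excluded_def)
  ultimately show ?thesis
    using selected e(1) by (simp add: attempt_def wp_simps attempt_result_def)
next
  case True
  note letter_e = e(3)[OF True]
  obtain C where C: "selection S B C" "tabulates (length S) (cover S C) (arrs s Own)"
    using selected by (auto simp: selected_def)
  interpret FT3_insertion S B C e "arrs s Own"
    by unfold_locales (use C True letter_e a count in auto)
  let ?s = "set_var Low (prev_occ S e) s"
  have len': "vars ?s Len = length S" using len by simp
  have "wp clear (wp (search ;; IfPos Ok commit Skip) ?Q) ?s (t + 2)"
  proof (rule wp_conseq[OF clear_correct[OF len']], elim conjE)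
    fix s1 t1
    assume frame: "frame clear ?s s1" and t1: "t1 \<le> t + 2 + 4 * length S + 3"
      and zero: "\<forall>k\<in>{1..length S}. arrs s1 New k = 0 \<and> arrs s1 Flip k = 0"
    have "tables S (length S) s1" "arrs s1 Own = arrs s Own" "vars s1 End = e"
      "vars s1 Len = length S"
      using tables len e(1) frame by (simp_all add: tables_def frame_def)
    from search_commit_correct[OF this] zero
    have "wp (search ;; IfPos Ok commit Skip)
        (\<lambda>s' t'. attempt_result S B a e s' \<and> t' \<le> t1 + 32 * length S + 35) s1 t1"
      unfolding letter_e by blast
    then show "wp (search ;; IfPos Ok commit Skip) ?Q s1 t1"
      by (rule wp_conseq) (use t1 in auto)
  qed
  moreover have "arrs s Prev e = prev_occ S e" "0 < prev_occ S e"
    using tablesD(2)[OF tables e(2)] pair_endsD(1)[OF True] by auto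
  ultimately show ?thesis using e(1) by (simp add: attempt_def wp_simps eval_nat_numeral)
qed

section \<open>Correctness of the program\<close>

definition insert_result :: "nat list \<Rightarrow> nat set \<Rightarrow> (var, arr) state \<Rightarrow> bool" where
  "insert_result S B s \<longleftrightarrow>
     (if vars s Ok = 0 then \<nexists>C. selection S B C else vars s Ok = 1 \<and> selected S B s)"

lemma insert_result_vars_update [simp]:
  "V Ok = vars s Ok \<Longrightarrow> insert_result S B (s\<lparr>vars := V\<rparr>) \<longleftrightarrow> insert_result S B s"
  by (simp add: insert_result_def)

lemma second_attempt_correct:
  assumes count: "\<And>a. count_list S a \<le> 3" and tables: "tables S (length S) s"
    and len: "vars s Len = length S" and cur: "vars s Cur = a" and a: "a \<notin> B"
    and first: "selected S B s" "excluded S B (last_occ S a (length S))"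
  shows "wp (Get End Last Cur ;; Get End Prev End ;; attempt)
    (\<lambda>s' t'. insert_result S (insert a B) s' \<and> t' \<le> t + 36 * length S + 42) s t"
    (is "wp _ ?Q s t")
proof -
  define l where "l = last_occ S a (length S)"
  let ?p = "prev_occ S l"
  let ?s = "set_var End ?p s"
  have "l \<le> length S" by (simp add: l_def last_occ_le)
  moreover have "?p \<le> l" by (rule prev_occ_le)
  moreover have "letter S ?p = a" if "?p \<in> pair_ends S"
    using pair_endsD(3)[OF that] letter_prev_occ[of S l] \<open>?p \<le> l\<close> letter_last_occ[of S a "length S"]
    by (simp add: l_def)
  ultimately have "wp attempt
      (\<lambda>s' t'. attempt_result S B a ?p s' \<and> t' \<le> t + 2 + 36 * length S + 40) ?s (t + 2)"
    using tables len a first(1) by (intro attempt_correct count) (auto simp: tables_def)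
  then have "wp attempt ?Q ?s (t + 2)"
    by (rule wp_conseq)
      (use no_selection_if_excluded[OF count first(2)] in
        \<open>auto simp: attempt_result_def insert_result_def l_def split: if_splits\<close>)
  then show ?thesis
    using cur tablesD(1)[OF tables] tablesD(2)[OF tables \<open>l \<le> length S\<close>]
    by (simp add: wp_simps l_def)
qed

lemma insert_letter_correct:
  assumes count: "\<And>a. count_list S a \<le> 3" and tables: "tables S (length S) s"
    and len: "vars s Len = length S" and selected: "selected S B s"
    and cur: "vars s Cur = a" and a: "a \<notin> B"
  shows "wp insert_letter
    (\<lambda>s' t'. insert_result S (insert a B) s' \<and> t' \<le> t + 72 * length S + 84) s t"
    (is "wp _ ?Q s t")
proof -
  define l where "l = last_occ S a (length S)"
  let ?s = "set_var End l s"
  let ?retry = "IfPos Ok Skip (Get End Last Cur ;; Get End Prev End ;; attempt)"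
  have "l \<le> length S" by (simp add: l_def last_occ_le)
  moreover have "letter S l = a" if "l \<in> pair_ends S"
    using pair_endsD(3)[OF that] letter_last_occ[of S a "length S"] by (simp add: l_def)
  ultimately have "wp attempt
      (\<lambda>s' t'. attempt_result S B a l s' \<and> t' \<le> t + 1 + 36 * length S + 40) ?s (t + 1)"
    using tables len selected a by (intro attempt_correct count) (auto simp: tables_def)
  then have "wp attempt (wp ?retry ?Q) ?s (t + 1)"
  proof (rule wp_conseq, elim conjE)
    fix s1 t1
    assume frame: "frame attempt ?s s1" and result: "attempt_result S B a l s1"
      and t1: "t1 \<le> t + 1 + 36 * length S + 40"
    show "wp ?retry ?Q s1 t1"
    proof (cases "vars s1 Ok = 0")
      case False
      then show ?thesis
        using result t1 by (simp add: wp_simps attempt_result_def insert_result_def)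
    next
      case True
      have "tables S (length S) s1" "vars s1 Len = length S" "vars s1 Cur = a"
        using tables len cur frame by (simp_all add: tables_def frame_def)
      moreover have "selected S B s1" "excluded S B (last_occ S a (length S))"
        using result True by (simp_all add: attempt_result_def l_def)
      ultimately have "wp (Get End Last Cur ;; Get End Prev End ;; attempt)
          (\<lambda>s' t'. insert_result S (insert a B) s' \<and> t' \<le> t1 + 1 + 36 * length S + 42) s1 (t1 + 1)"
        by (intro second_attempt_correct count a)
      then show ?thesis
        unfolding wp_IfPos using True t1 by (auto elim!: wp_conseq)
    qed
  qed
  then show ?thesis
    using cur tablesD(1)[OF tables] by (simp add: insert_letter_def wp_simps l_def)
qed

lemma insert_letter_unless_failed_correct:
  assumes count: "\<And>a. count_list S a \<le> 3" and tables: "tables S (length S) s"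
    and len: "vars s Len = length S" and result: "insert_result S B s"
    and cur: "vars s Cur = a" and a: "a \<notin> B"
  shows "wp (IfPos Ok insert_letter Skip)
    (\<lambda>s' t'. insert_result S (insert a B) s' \<and> t' \<le> t + 72 * length S + 85) s t"
proof (cases "vars s Ok = 0")
  case True
  then have "\<nexists>C. selection S (insert a B) C"
    using result selection_restrict[of S "insert a B" _ B] by (auto simp: insert_result_def)
  then show ?thesis using True by (simp add: wp_simps insert_result_def)
next
  case False
  then have "selected S B s" using result by (simp add: insert_result_def)
  from insert_letter_correct[OF count tables len this cur a, of "t + 1"]
  show ?thesis unfolding wp_IfPos using False by (auto elim!: wp_conseq)
qed

lemma insert_letters_correct:
  assumes count: "\<And>a. count_list S a \<le> 3" and tables: "tables S (length S) s"
    and len: "vars s Len = length S" and todo: "vars s Todo = \<sigma>"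
    and empty: "\<And>k. arrs s Own k = 0"
  shows "wp insert_letters (\<lambda>s' t'. insert_result S {..<\<sigma>} s' \<and>
    t' \<le> t + (72 * length S + 88) * \<sigma> + 3) s t"
proof -
  let ?body = "Cur ::= Pred Todo ;; IfPos Ok insert_letter Skip" and ?n = "length S"
  let ?s = "set_var Ok 1 (set_var Tmp 0 s)"
  have "selection S {\<sigma>..<\<sigma>} {}" "tabulates ?n (cover S {}) (arrs s Own)"
    using empty selection_empty by (auto simp: tabulates_def cover_def)
  then have init: "insert_result S {\<sigma>..<\<sigma>} ?s"
    unfolding insert_result_def selected_def by auto
  have "wp (countdown Todo ?body) (\<lambda>s' t'. insert_result S {0..<\<sigma>} s' \<and>
    t' \<le> (t + 2) + ((72 * ?n + 86) + 2) * \<sigma> + 1) ?s (t + 2)"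
  proof (rule wp_countdown[where I = "\<lambda>k. insert_result S {k..<\<sigma>}"])
    fix k s' t'
    assume "k < \<sigma>" and frame: "frame (countdown Todo ?body) ?s s'"
      and result: "insert_result S {Suc k..<\<sigma>} s'" and "vars s' Todo = Suc k"
    then have "{k..<\<sigma>} = insert k {Suc k..<\<sigma>}" by auto
    moreover have "tables S ?n (set_var Cur k s')" "vars (set_var Cur k s') Len = ?n"
      using tables len frame by (simp_all add: tables_def frame_def countdown_def)
    from insert_letter_unless_failed_correct[OF count this, of "{Suc k..<\<sigma>}" k "t' + 1"] result
    have "wp (IfPos Ok insert_letter Skip) (\<lambda>s'' t''. insert_result S (insert k {Suc k..<\<sigma>}) s'' \<and>
        t'' \<le> t' + 1 + 72 * ?n + 85) (set_var Cur k s') (t' + 1)" by simp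
    ultimately show "wp ?body (\<lambda>s'' t''. insert_result S {k..<\<sigma>} (set_var Todo k s'') \<and>
      t'' \<le> t' + (72 * ?n + 86)) s' t'"
      unfolding wp_Seq wp_Assign using \<open>vars s' Todo = Suc k\<close> by (auto elim!: wp_conseq)
  qed (use init todo in auto)
  then show ?thesis
    using todo
    by (auto simp: insert_letters_def wp_simps lessThan_atLeast0 add.commute elim!: wp_conseq)
qed

lemma count_list_le_if_FT_instance:
  assumes "(\<sigma>, S) \<in> FT_instances d"
  shows "count_list S a \<le> d"
proof (cases "a < \<sigma>")
  case False
  then have "a \<notin> set S" using assms by (auto simp: FT_instances_def)
  then show ?thesis by (simp add: count_list_0_iff)
qed (use assms in \<open>auto simp: FT_instances_def\<close>)

lemma load_insert_letters_correct:
  assumes count: "\<And>a. count_list S a \<le> 3" and \<sigma>: "\<sigma> \<le> length S"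
    and len: "vars s Len = length S" and todo: "vars s Todo = \<sigma>"
    and arrs: "arrs s = (\<lambda>_ _. 0)" and inp: "input s = S"
  shows "wp (load ;; insert_letters) (\<lambda>s' t'. insert_result S {..<\<sigma>} s' \<and>
    t' \<le> t + 72 * (length S)\<^sup>2 + 99 * length S + 6) s t"
    (is "wp _ ?Q s t")
proof -
  have "tables S 0 s"
    using arrs by (auto simp: tables_def tabulates_def siblings_def pair_ends_def)
  then have "wp load (wp insert_letters ?Q) s t"
  proof (rule wp_conseq[OF load_correct[OF count _ len inp]], elim conjE)
    fix s1 t1
    assume frame: "frame load s s1" and tables: "tables S (length S) s1"
      and t1: "t1 \<le> t + 11 * length S + 3"
    have "(72 * length S + 88) * \<sigma> \<le> (72 * length S + 88) * length S"
      using \<sigma> by (rule mult_le_mono2)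
    then have time: "t1 + (72 * length S + 88) * \<sigma> + 3 \<le> t + 72 * (length S)\<^sup>2 + 99 * length S + 6"
      using t1 by (simp add: power2_eq_square algebra_simps)
    have "wp insert_letters (\<lambda>s' t'. insert_result S {..<\<sigma>} s' \<and>
        t' \<le> t1 + (72 * length S + 88) * \<sigma> + 3) s1 t1"
      using frame len todo arrs
      by (intro insert_letters_correct count tables) (simp_all add: frame_def)
    then show "wp insert_letters ?Q s1 t1" by (rule wp_conseq) (use time in auto)
  qed
  then show ?thesis by (simp add: wp_Seq)
qed

theorem FT3_correct:
  assumes "(\<sigma>, S) \<in> FT_instances 3"
  shows "wp FT3 (\<lambda>s t. vars s Ok = (if FT_solvable (\<sigma>, S) then 1 else 0) \<and>
    t \<le> 100 * (length S + 1)\<^sup>2) (initial (FT_encoding (\<sigma>, S))) 0"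
    (is "wp _ ?Q _ _")
proof (cases "\<sigma> \<le> length S")
  case False
  then have "\<not> FT_solvable (\<sigma>, S)"
    using selection_card_le[of S "{..<\<sigma>}"] by (auto simp: FT_solvable_iff_selection)
  then show ?thesis
    using False by (simp add: FT3_def wp_simps initial_def FT_encoding_def power2_eq_square)
next
  case True
  let ?s = "initial S\<lparr>vars := (\<lambda>_. 0)(Todo := \<sigma>, Len := length S, Tmp := 0)\<rparr>"
  have "wp (load ;; insert_letters) (\<lambda>s' t'. insert_result S {..<\<sigma>} s' \<and>
      t' \<le> 4 + 72 * (length S)\<^sup>2 + 99 * length S + 6) ?s 4"
    by (rule load_insert_letters_correct)
      (use count_list_le_if_FT_instance[OF assms] True in \<open>simp_all add: initial_def\<close>)
  then have "wp (load ;; insert_letters) ?Q ?s 4"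
    by (rule wp_conseq)
      (auto simp: insert_result_def selected_def FT_solvable_iff_selection power2_eq_square
        split: if_splits)
  then show ?thesis
    using True by (simp add: FT3_def wp_simps initial_def FT_encoding_def eval_nat_numeral)
qed

lemma FT3_time_le_power: "100 * (n + 1)\<^sup>2 \<le> (n + 4) ^ 6" for n :: nat
proof -
  have "100 * (n + 1)\<^sup>2 \<le> 4 ^ 4 * (n + 4)\<^sup>2" by (intro mult_mono power_mono) simp_all
  also have "\<dots> \<le> (n + 4) ^ 4 * (n + 4)\<^sup>2" by (intro mult_right_mono power_mono) simp_all
  also have "\<dots> = (n + 4) ^ 6" by (simp flip: power_add)
  finally show ?thesis .
qed

primrec var_register :: "var \<Rightarrow> nat" where
  "var_register Ok = 0" | "var_register Todo = 1" | "var_register Len = 2" | "var_register Cnt = 3"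
| "var_register Pos = 4" | "var_register Cur = 5" | "var_register Go = 6" | "var_register End = 7"
| "var_register Low = 8" | "var_register Tmp = 9" | "var_register Owner = 10"
| "var_register Hd = 11" | "var_register Tl = 12"

primrec arr_slot :: "arr \<Rightarrow> nat" where
  "arr_slot Last = 0" | "arr_slot Prev = 1" | "arr_slot Sibling = 2" | "arr_slot Own = 3"
| "arr_slot New = 4" | "arr_slot Flip = 5" | "arr_slot Queue = 6"

interpretation FT3_layout: layout var_register arr_slot 4
proof
  show "inj var_register"
  proof (rule injI)
    fix x y show "var_register x = var_register y \<Longrightarrow> x = y" by (cases x; cases y) simp_all
  qed
  show "inj arr_slot"
  proof (rule injI)
    fix f g show "arr_slot f = arr_slot g \<Longrightarrow> f = g" by (cases f; cases g) simp_all
  qed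
  show "var_register x + 2 < 2 ^ 4" for x by (cases x) simp_all
  show "arr_slot f < 2 ^ 4" for f by (cases f) simp_all
qed

theorem theorem2:
  "decidable_in_time_O (FT_instances 3) FT_encoding FT_size FT_solvable (\<lambda>n. real n ^ 2)"
proof (rule FT3_layout.decidable_in_time_O_if_wp)
  show "var_register Ok = 0" by simp
  show "(\<lambda>n. real (100 * (n + 1)\<^sup>2)) \<in> O(\<lambda>n. real n ^ 2)" by real_asymp
next
  fix x :: "nat \<times> nat list" assume x: "x \<in> FT_instances 3"
  obtain \<sigma> S where x_eq: "x = (\<sigma>, S)" by (cases x)
  show "wp FT3 (\<lambda>s t. vars s Ok = (if FT_solvable x then 1 else 0) \<and>
      t \<le> 100 * (FT_size x + 1)\<^sup>2) (initial (FT_encoding x)) 0"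
    using FT3_correct x by (simp add: x_eq FT_size_def)
  have "FT_size x = length S" "length (FT_encoding x) + 2 = length S + 4"
    by (simp_all add: x_eq FT_size_def FT_encoding_def)
  then show "100 * (FT_size x + 1)\<^sup>2 \<le> (length (FT_encoding x) + 2) ^ 6"
    using FT3_time_le_power[of "length S"] by metis
qed

end
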